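(* Let $n$ be odd and let $G$ be a finite connected graph with a harmonic action of $D_n=\langle\sigma_1,\sigma_2\rangle$ as described in the context, with vertices labeled $z_i^j$ ($1\le j\le s$) and $x_i^j,y_i^j$ ($1\le j\le t$), $i\in\{1,\dots,n\}$. Let $\delta$ be a divisor of degree zero on $G$. Then $\delta\in\mathcal{P}=\mathcal{P}_1+\mathcal{P}_2+\mathcal{P}_3$ if and only if: (1) $\sum_{i=1}^n i\,(X_i+Y_i+Z_i)\equiv 0\pmod n$, where $X_i=\sum_{j=1}^t\delta(x_i^j)$, $Y_i=\sum_{j=1}^t\delta(y_i^j)$, $Z_i=\sum_{j=1}^s\delta(z_i^j)$; and (2) for each $j=1,\dots,t$, $\sum_{i=1}^n\delta(x_i^j)\equiv\sum_{i=1}^n\delta(y_i^j)\pmod n$.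
   Context: Graphs are finite, connected, may have multiple edges, no loops. A divisor on $G$ is a function from the vertex set to $\mathbb{Z}$; its degree is the sum of its values. Setting: $D_n$ is the dihedral group of order $2n$ generated by involutions $\sigma_1,\sigma_2$, acting on $G$ by automorphisms harmonically (no non-identity element fixes both endpoints of an edge), and every $D_n$-orbit of vertices has $n$ or $2n$ points. The vertices are labeled so that there are $s$ orbits of size $n$, $\{z_i^j: i=1,\dots,n\}$ for $j=1,\dots,s$, and $t$ orbits of size $2n$, $\{x_i^j,y_i^j\}$ for $j=1,\dots,t$, with (subscripts mod $n$) $\sigma_1(z_i^j)=z_{n+1-i}^j$, $\sigma_1(x_i^j)=y_{n+1-i}^j$, $\sigma_1(y_i^j)=x_{n+1-i}^j$, $\sigma_2(z_i^j)=z_{n+2-i}^j$, $\sigma_2(x_i^j)=y_{n+2-i}^j$, $\sigma_2(y_i^j)=x_{n+2-i}^j$. For a subgroup $\Gamma$ the quotient graph $G/\Gamma$ has vertices the $\Gamma$-orbits of vertices and edges the $\Gamma$-orbits of edges, quotient map $\phi$; the pullback of a divisor $\hat D$ on $G/\Gamma$ is $\phi^*(\hat D)(v)=|\mathrm{Stab}_\Gamma(v)|\,\hat D(\phi(v))$. Let $H_1=G/\langle\sigma_1\rangle$, $H_2=G/\langle\sigma_2\rangle$, $H_3=G/\langle\sigma_1\sigma_2\rangle$, let $\mathcal{P}_k$ be the set of divisors $\phi_k^*(\hat D)$ with $\hat D$ of degree zero on $H_k$, and $\mathcal{P}_1+\mathcal{P}_2+\mathcal{P}_3$ the set of sums $\delta_1+\delta_2+\delta_3$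 with $\delta_k\in\mathcal{P}_k$. *)

theory Defs
  imports
    "HOL-Algebra.Group_Action"
    "HOL-Algebra.Elementary_Groups"
    "HOL-Number_Theory.Cong"
begin

text \<open>
  Undirected graphs with possible multiple edges: each edge is sent to the set of its endpoints.
  A loop would be an edge whose set of endpoints is a singleton; the record type itself admits
  these, because they can arise in a quotient.
\<close>

record ('v, 'e) multigraph =
  verts :: "'v set"
  edges :: "'e set"
  ends :: "'e \<Rightarrow> 'v set"

definition adj_rel :: "('v, 'e) multigraph \<Rightarrow> 'v rel" where
  "adj_rel G = {(u, v). \<exists>e\<in>edges G. ends G e = {u, v}}"

definition connected_graph :: "('v, 'e) multigraph \<Rightarrow> bool" where
  "connected_graph G \<longleftrightarrow>
     verts G \<noteq> {} \<and> (\<forall>u\<in>verts G. \<forall>v\<in>verts G. (u, v) \<in> (adj_rel G)\<^sup>*)"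

definition finite_loopless_graph :: "('v, 'e) multigraph \<Rightarrow> bool" where
  "finite_loopless_graph G \<longleftrightarrow>
     finite (verts G) \<and> finite (edges G) \<and>
     (\<forall>e\<in>edges G. ends G e \<subseteq> verts G \<and> card (ends G e) = 2)"

definition graph_action ::
  "('g, 'm) monoid_scheme \<Rightarrow> ('v, 'e) multigraph \<Rightarrow> ('g \<Rightarrow> 'v \<Rightarrow> 'v) \<Rightarrow> ('g \<Rightarrow> 'e \<Rightarrow> 'e) \<Rightarrow> bool"
where
  "graph_action \<Gamma> G \<phi> \<psi> \<longleftrightarrow>
     group_action \<Gamma> (verts G) \<phi> \<and> group_action \<Gamma> (edges G) \<psi> \<and>
     (\<forall>g\<in>carrier \<Gamma>. \<forall>e\<in>edges G. ends G (\<psi> g e) = \<phi> g ` ends G e)"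

definition harmonic_action ::
  "('g, 'm) monoid_scheme \<Rightarrow> ('v, 'e) multigraph \<Rightarrow> ('g \<Rightarrow> 'v \<Rightarrow> 'v) \<Rightarrow> ('g \<Rightarrow> 'e \<Rightarrow> 'e) \<Rightarrow> bool"
where
  "harmonic_action \<Gamma> G \<phi> \<psi> \<longleftrightarrow>
     graph_action \<Gamma> G \<phi> \<psi> \<and>
     (\<forall>g\<in>carrier \<Gamma>. \<forall>e\<in>edges G. (\<forall>v\<in>ends G e. \<phi> g v = v) \<longrightarrow> g = \<one>\<^bsub>\<Gamma>\<^esub>)"

definition dihedral_group :: "('g, 'm) monoid_scheme \<Rightarrow> nat \<Rightarrow> 'g \<Rightarrow> 'g \<Rightarrow> bool" where
  "dihedral_group D n \<sigma>\<^sub>1 \<sigma>\<^sub>2 \<longleftrightarrow>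
     group D \<and> order D = 2 * n \<and>
     \<sigma>\<^sub>1 \<in> carrier D \<and> \<sigma>\<^sub>1 \<noteq> \<one>\<^bsub>D\<^esub> \<and> \<sigma>\<^sub>1 \<otimes>\<^bsub>D\<^esub> \<sigma>\<^sub>1 = \<one>\<^bsub>D\<^esub> \<and>
     \<sigma>\<^sub>2 \<in> carrier D \<and> \<sigma>\<^sub>2 \<noteq> \<one>\<^bsub>D\<^esub> \<and> \<sigma>\<^sub>2 \<otimes>\<^bsub>D\<^esub> \<sigma>\<^sub>2 = \<one>\<^bsub>D\<^esub> \<and>
     generate D {\<sigma>\<^sub>1, \<sigma>\<^sub>2} = carrier D"

text \<open>
  The endpoints of an edge orbit are the orbits of the endpoints of any of its members; the union
  over all members avoids choosing a representative.
\<close>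

definition quotient_graph ::
  "('g, 'm) monoid_scheme \<Rightarrow> ('v, 'e) multigraph \<Rightarrow> ('g \<Rightarrow> 'v \<Rightarrow> 'v) \<Rightarrow> ('g \<Rightarrow> 'e \<Rightarrow> 'e)
     \<Rightarrow> ('v set, 'e set) multigraph"
where
  "quotient_graph \<Gamma> G \<phi> \<psi> =
     \<lparr>verts = orbits \<Gamma> (verts G) \<phi>,
      edges = orbits \<Gamma> (edges G) \<psi>,
      ends = (\<lambda>E. orbit \<Gamma> \<phi> ` (\<Union>e\<in>E. ends G e))\<rparr>"

text \<open>
  A function on the vertex set is represented by its extension by zero, so that equality of
  divisors is equality of functions.
\<close>

definition divisors :: "('v, 'e) multigraph \<Rightarrow> ('v \<Rightarrow> int) set" where
  "divisors G = {\<delta>. \<forall>v. v \<notin> verts G \<longrightarrow> \<delta> v = 0}"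

definition divisor_degree :: "('v, 'e) multigraph \<Rightarrow> ('v \<Rightarrow> int) \<Rightarrow> int" where
  "divisor_degree G \<delta> = (\<Sum>v\<in>verts G. \<delta> v)"

definition pullback ::
  "('g, 'm) monoid_scheme \<Rightarrow> ('v, 'e) multigraph \<Rightarrow> ('g \<Rightarrow> 'v \<Rightarrow> 'v) \<Rightarrow> ('v set \<Rightarrow> int) \<Rightarrow> 'v \<Rightarrow> int"
where
  "pullback \<Gamma> G \<phi> \<delta> =
     (\<lambda>v. if v \<in> verts G then int (card (stabilizer \<Gamma> \<phi> v)) * \<delta> (orbit \<Gamma> \<phi> v) else 0)"

definition pullbacks_deg0 ::
  "('g, 'm) monoid_scheme \<Rightarrow> ('v, 'e) multigraph \<Rightarrow> ('g \<Rightarrow> 'v \<Rightarrow> 'v) \<Rightarrow> ('g \<Rightarrow> 'e \<Rightarrow> 'e)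
     \<Rightarrow> ('v \<Rightarrow> int) set"
where
  "pullbacks_deg0 \<Gamma> G \<phi> \<psi> =
     {pullback \<Gamma> G \<phi> \<delta> | \<delta>.
        \<delta> \<in> divisors (quotient_graph \<Gamma> G \<phi> \<psi>) \<and>
        divisor_degree (quotient_graph \<Gamma> G \<phi> \<psi>) \<delta> = 0}"

definition pullback_sum ::
  "('g, 'm) monoid_scheme \<Rightarrow> 'g \<Rightarrow> 'g \<Rightarrow> ('v, 'e) multigraph \<Rightarrow> ('g \<Rightarrow> 'v \<Rightarrow> 'v) \<Rightarrow> ('g \<Rightarrow> 'e \<Rightarrow> 'e)
     \<Rightarrow> ('v \<Rightarrow> int) set"
where
  "pullback_sum D \<sigma>\<^sub>1 \<sigma>\<^sub>2 G \<phi> \<psi> =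
     {(\<lambda>v. \<delta>\<^sub>1 v + \<delta>\<^sub>2 v + \<delta>\<^sub>3 v) | \<delta>\<^sub>1 \<delta>\<^sub>2 \<delta>\<^sub>3.
        \<delta>\<^sub>1 \<in> pullbacks_deg0 (subgroup_generated D {\<sigma>\<^sub>1}) G \<phi> \<psi> \<and>
        \<delta>\<^sub>2 \<in> pullbacks_deg0 (subgroup_generated D {\<sigma>\<^sub>2}) G \<phi> \<psi> \<and>
        \<delta>\<^sub>3 \<in> pullbacks_deg0 (subgroup_generated D {\<sigma>\<^sub>1 \<otimes>\<^bsub>D\<^esub> \<sigma>\<^sub>2}) G \<phi> \<psi>}"

text \<open>
  Subscripts modulo \<open>n\<close> are integers, with labels periodic of period \<open>n\<close> in the subscript. That the
  \<open>n\<close> (resp. \<open>2n\<close>) labels of an orbit are distinct is contained in the cardinalities of the orbits.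
\<close>

definition dihedral_labelling ::
  "('g, 'm) monoid_scheme \<Rightarrow> nat \<Rightarrow> 'g \<Rightarrow> 'g \<Rightarrow> ('v, 'e) multigraph \<Rightarrow> ('g \<Rightarrow> 'v \<Rightarrow> 'v)
     \<Rightarrow> nat \<Rightarrow> nat \<Rightarrow> (int \<Rightarrow> nat \<Rightarrow> 'v) \<Rightarrow> (int \<Rightarrow> nat \<Rightarrow> 'v) \<Rightarrow> (int \<Rightarrow> nat \<Rightarrow> 'v) \<Rightarrow> bool"
where
  "dihedral_labelling D n \<sigma>\<^sub>1 \<sigma>\<^sub>2 G \<phi> s t z x y \<longleftrightarrow>
     bij_betw (\<lambda>j. {z i j | i. i \<in> {1..int n}})
       {1..s} {B \<in> orbits D (verts G) \<phi>. card B = n} \<and>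
     bij_betw (\<lambda>j. {x i j | i. i \<in> {1..int n}} \<union> {y i j | i. i \<in> {1..int n}})
       {1..t} {B \<in> orbits D (verts G) \<phi>. card B = 2 * n} \<and>
     (\<forall>j\<in>{1..s}. \<forall>i.
        z (i + int n) j = z i j \<and>
        \<phi> \<sigma>\<^sub>1 (z i j) = z (int n + 1 - i) j \<and>
        \<phi> \<sigma>\<^sub>2 (z i j) = z (int n + 2 - i) j) \<and>
     (\<forall>j\<in>{1..t}. \<forall>i.
        x (i + int n) j = x i j \<and> y (i + int n) j = y i j \<and>
        \<phi> \<sigma>\<^sub>1 (x i j) = y (int n + 1 - i) j \<and> \<phi> \<sigma>\<^sub>1 (y i j) = x (int n + 1 - i) j \<and>
        \<phi> \<sigma>\<^sub>2 (x i j) = y (int n + 2 - i) j \<and> \<phi> \<sigma>\<^sub>2 (y i j) = x (int n + 2 - i) j)"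

end

theory Submission
  imports Defs
begin

text \<open>
  Write \<open>A\<^sub>k(d)\<close> for the pullbacks to \<open>G\<close> of divisors of degree \<open>d\<close> on \<open>H\<^sub>k\<close>, and \<open>A\<^sub>k\<close> for the union over
  all \<open>d\<close>. Let the weight of a divisor \<open>f\<close> be the left-hand side of condition (1). If \<open>f\<close> is invariant
  under \<open>\<sigma>\<^sub>k\<close>, which sends the index \<open>i\<close> to \<open>k - i\<close>, then twice the weight is \<open>k\<close> times the degree of \<open>f\<close>
  modulo \<open>n\<close>; since \<open>n\<close> is odd, the weight is \<open>d\<close> on \<open>A\<^sub>1(d)\<close> and \<open>2d\<close> on \<open>A\<^sub>2(d)\<close>. It is \<open>0\<close> on \<open>A\<^sub>3\<close>.
  This gives necessity.

  For sufficiency, condition (2) alone puts \<open>\<delta>\<close> into \<open>A\<^sub>1 + A\<^sub>2 + A\<^sub>3\<close>: this group contains all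
  differences \<open>x\<^sub>i - x\<^sub>k\<close>, all sums \<open>x\<^sub>i + y\<^sub>k\<close>, all multiples \<open>n x\<^sub>i\<close>, and every \<open>z\<^sub>i\<close>, because \<open>n z\<^sub>i\<close> and
  \<open>2 z\<^sub>i\<close> lie in it. If the summands have degrees \<open>d\<^sub>1, d\<^sub>2, d\<^sub>3\<close> on the quotients, then
  \<open>2 d\<^sub>1 + 2 d\<^sub>2 + n d\<^sub>3 = 0\<close> and, by (1), \<open>d\<^sub>1 + 2 d\<^sub>2\<close> is divisible by \<open>n\<close>; hence \<open>n\<close> divides \<open>d\<^sub>1\<close> and
  \<open>d\<^sub>2\<close>, and \<open>d\<^sub>3\<close> is even. The sum of all \<open>D\<^sub>n\<close>-translates of a vertex lies in \<open>A\<^sub>1(n)\<close>, \<open>A\<^sub>2(n)\<close> and \<open>A\<^sub>3(2)\<close>,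
  so shifting multiples of it between the summands makes all three degrees vanish.
\<close>

section \<open>Sums of periodic functions\<close>

lemma periodic_mod:
  fixes p :: "int \<Rightarrow> 'a"
  assumes per: "\<And>i. p (i + int n) = p i" and "[i = k] (mod int n)"
  shows "p i = p k"
proof -
  have up: "p (i + int n * int m) = p i" for i m
  proof (induction m)
    case (Suc m)
    have "p (i + int n * int (Suc m)) = p ((i + int n * int m) + int n)"
      by (simp add: algebra_simps)
    then show ?case using per Suc by simp
  qed simp
  obtain c where c: "k = i + int n * c"
    using assms(2) by (auto simp: cong_iff_lin)
  \<comment> \<open>\<open>up\<close> only covers natural multiples of the period; for negative
    \<open>c\<close> it is applied from \<open>k\<close> back to \<open>i\<close>.\<close>
  show ?thesis
    using up[of i "nat c"] up[of k "nat (- c)"] by (cases "c \<ge> 0") (auto simp: c)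
qed

text \<open>Both sums run over one full residue system modulo \<open>n\<close>, and a reflection
  permutes the residues.\<close>

lemma sum_periodic_reflect:
  fixes f :: "int \<Rightarrow> 'a :: comm_monoid_add"
  assumes per: "\<And>i. f (i + int n) = f i" and "n > 0"
  shows "(\<Sum>i=1..int n. f (c - i)) = (\<Sum>i=1..int n. f i)"
proof -
  \<comment> \<open>The representative of \<open>i\<close> in \<open>{1..int n}\<close> instead of
    \<open>{0..<int n}\<close>, hence the shift by one before and after \<open>mod\<close>.\<close>
  define r where "r i = (i - 1) mod int n + 1" for i
  have f_r: "f (r i) = f i" for i
    by (rule periodic_mod[where p=f, OF per]) (simp add: r_def cong_def mod_simps)
  have r_range: "r i \<in> {1..int n}" for i
    using \<open>n > 0\<close> by (simp add: r_def add1_zle_eq)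
  have r_id: "r i = i" if "i \<in> {1..int n}" for i
    using that by (simp add: r_def)
  have r_reflect: "r (c - r (c - i)) = r i" for i
  proof -
    have "(c - ((c - i - 1) mod int n + 1) - 1) mod int n
        = (c - 2 - (c - i - 1) mod int n) mod int n" by (simp add: algebra_simps)
    also have "\<dots> = (c - 2 - (c - i - 1)) mod int n" by (rule mod_diff_right_eq)
    also have "\<dots> = (i - 1) mod int n" by (simp add: algebra_simps)
    finally show ?thesis by (simp add: r_def)
  qed
  \<comment> \<open>The map \<open>\<lambda>i. r (c - i)\<close> is an involution of
    \<open>{1..int n}\<close>, so it serves as its own inverse in the reindexing.\<close>
  show ?thesis
    by (rule sum.reindex_bij_witness[where i="\<lambda>i. r (c - i)" and j="\<lambda>i. r (c - i)"])
       (use r_range r_id r_reflect f_r in auto)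
qed

text \<open>The summand \<open>i * f i\<close> is not periodic, but it becomes so once the factor
  \<open>i\<close> is replaced by its residue, which changes the sum only by a multiple of
  \<open>n\<close>. Reflection then applies to the periodic summand.\<close>

lemma weighted_sum_periodic_reflect:
  fixes f :: "int \<Rightarrow> int"
  assumes per: "\<And>i. f (i + int n) = f i" and "n > 0"
  shows "[(\<Sum>i=1..int n. (c - i) * f (c - i)) = (\<Sum>i=1..int n. i * f i)] (mod int n)"
proof -
  have "[(\<Sum>i=1..int n. (c - i) * f (c - i)) = (\<Sum>i=1..int n. ((c - i) mod int n) * f (c - i))] (mod int n)"
    by (intro cong_sum cong_mult) (simp_all add: cong_def)
  also have "(\<Sum>i=1..int n. ((c - i) mod int n) * f (c - i)) = (\<Sum>i=1..int n. (i mod int n) * f i)"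
    by (rule sum_periodic_reflect) (simp_all add: per \<open>n > 0\<close>)
  also have "[(\<Sum>i=1..int n. (i mod int n) * f i) = (\<Sum>i=1..int n. i * f i)] (mod int n)"
    by (intro cong_sum cong_mult) (simp_all add: cong_def)
  finally show ?thesis .
qed

section \<open>Pullbacks of divisors of a given degree\<close>

text \<open>The degree on the quotient is a parameter because the decomposition of a divisor is
  first found with arbitrary degrees, which are corrected to zero afterwards.\<close>

definition pullbacks_deg ::
  "('g, 'm) monoid_scheme \<Rightarrow> ('v, 'e) multigraph \<Rightarrow> ('g \<Rightarrow> 'v \<Rightarrow> 'v) \<Rightarrow> int \<Rightarrow> ('v \<Rightarrow> int) set"
where
  "pullbacks_deg \<Gamma> G \<phi> d =
     {pullback \<Gamma> G \<phi> \<delta> | \<delta>.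
        (\<forall>B. B \<notin> orbits \<Gamma> (verts G) \<phi> \<longrightarrow> \<delta> B = 0) \<and> (\<Sum>B\<in>orbits \<Gamma> (verts G) \<phi>. \<delta> B) = d}"

lemma pullbacks_deg0_eq: "pullbacks_deg0 \<Gamma> G \<phi> \<psi> = pullbacks_deg \<Gamma> G \<phi> 0"
  by (simp add: pullbacks_deg0_def pullbacks_deg_def divisors_def divisor_degree_def
      quotient_graph_def)

lemma pullbacks_deg_lin:
  assumes "f \<in> pullbacks_deg \<Gamma> G \<phi> d" and "g \<in> pullbacks_deg \<Gamma> G \<phi> d'"
  shows "(\<lambda>v. a * f v + b * g v) \<in> pullbacks_deg \<Gamma> G \<phi> (a * d + b * d')"
proof -
  from assms obtain \<delta> \<delta>' where
    \<delta>: "f = pullback \<Gamma> G \<phi> \<delta>" "\<forall>B. B \<notin> orbits \<Gamma> (verts G) \<phi> \<longrightarrow> \<delta> B = 0"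
       "(\<Sum>B\<in>orbits \<Gamma> (verts G) \<phi>. \<delta> B) = d" and
    \<delta>': "g = pullback \<Gamma> G \<phi> \<delta>'" "\<forall>B. B \<notin> orbits \<Gamma> (verts G) \<phi> \<longrightarrow> \<delta>' B = 0"
       "(\<Sum>B\<in>orbits \<Gamma> (verts G) \<phi>. \<delta>' B) = d'"
    unfolding pullbacks_deg_def by blast
  show ?thesis unfolding pullbacks_deg_def
  proof (intro CollectI exI[of _ "\<lambda>B. a * \<delta> B + b * \<delta>' B"] conjI)
    show "(\<lambda>v. a * f v + b * g v) = pullback \<Gamma> G \<phi> (\<lambda>B. a * \<delta> B + b * \<delta>' B)"
      by (auto simp: \<delta>(1) \<delta>'(1) pullback_def algebra_simps)
  qed (use \<delta> \<delta>' in \<open>auto simp: sum.distrib sum_distrib_left\<close>)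
qed

lemma pullbacks_deg_zero: "(\<lambda>v. 0) \<in> pullbacks_deg \<Gamma> G \<phi> 0"
  unfolding pullbacks_deg_def
  by (intro CollectI exI[of _ "\<lambda>B. 0"]) (auto simp: pullback_def)

lemma pullbacks_deg_sum:
  assumes "finite I" and "\<And>i. i \<in> I \<Longrightarrow> f i \<in> pullbacks_deg \<Gamma> G \<phi> (d i)"
  shows "(\<lambda>v. \<Sum>i\<in>I. f i v) \<in> pullbacks_deg \<Gamma> G \<phi> (\<Sum>i\<in>I. d i)"
  using assms
proof (induction I rule: finite_induct)
  case empty
  then show ?case by (simp add: pullbacks_deg_zero)
next
  case (insert i I)
  then show ?case
    using pullbacks_deg_lin[of "f i" \<Gamma> G \<phi> "d i" "\<lambda>v. \<Sum>i\<in>I. f i v" "\<Sum>i\<in>I. d i" 1 1] by simp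
qed

lemma (in group_action) orbit_eq:
  assumes "v \<in> E" "w \<in> orbit G \<phi> v"
  shows "orbit G \<phi> w = orbit G \<phi> v"
proof -
  have "w \<in> E" using assms element_image by (auto simp: orbit_def)
  then show ?thesis
    using disjoint_union[of "orbit G \<phi> w" "orbit G \<phi> v"] orbit_refl[of w] assms
    by (auto simp: orbits_def)
qed

text \<open>This function is the pullback of a single quotient vertex with coefficient one. The
  explicit pullbacks for reflections and rotations below are instances of it.\<close>

lemma pullbacks_deg_orbit:
  assumes "group_action \<Gamma> (verts G) \<phi>" and "finite (verts G)" and v: "v \<in> verts G"
  shows "(\<lambda>w. if w \<in> orbit \<Gamma> \<phi> v then int (card (stabilizer \<Gamma> \<phi> w)) else 0) \<in> pullbacks_deg \<Gamma> G \<phi> 1"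
proof -
  interpret group_action \<Gamma> "verts G" \<phi> by fact
  have fin: "finite (orbits \<Gamma> (verts G) \<phi>)"
    using assms(2) by (simp add: orbits_def)
  have orb: "w \<in> orbit \<Gamma> \<phi> v \<longleftrightarrow> w \<in> verts G \<and> orbit \<Gamma> \<phi> w = orbit \<Gamma> \<phi> v" for w
    using orbit_eq[OF v] orbit_refl[of w] v element_image by (auto simp: orbit_def[of _ _ v])
  have v_orb: "orbit \<Gamma> \<phi> v \<in> orbits \<Gamma> (verts G) \<phi>"
    using v by (auto simp: orbits_def)
  show ?thesis unfolding pullbacks_deg_def
  proof (intro CollectI exI[of _ "\<lambda>B. if B = orbit \<Gamma> \<phi> v then 1 else 0"] conjI)
    show "(\<Sum>B\<in>orbits \<Gamma> (verts G) \<phi>. if B = orbit \<Gamma> \<phi> v then 1 else 0) = (1::int)"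
      using fin v_orb by simp
  qed (use v_orb in \<open>auto simp: orb pullback_def\<close>)
qed

text \<open>Within one orbit the stabilizer sizes add up to the order of the group, so each quotient
  vertex contributes its coefficient times that order.\<close>

lemma pullbacks_deg_degree:
  assumes "group_action \<Gamma> (verts G) \<phi>" and "finite (verts G)" and "finite (carrier \<Gamma>)"
    and "f \<in> pullbacks_deg \<Gamma> G \<phi> d"
  shows "(\<Sum>v\<in>verts G. f v) = int (order \<Gamma>) * d"
proof -
  interpret group_action \<Gamma> "verts G" \<phi> by fact
  from assms(4) obtain \<delta> where \<delta>: "f = pullback \<Gamma> G \<phi> \<delta>"
    "(\<Sum>B\<in>orbits \<Gamma> (verts G) \<phi>. \<delta> B) = d"
    unfolding pullbacks_deg_def by blast
  have "(\<Sum>v\<in>B. f v) = int (order \<Gamma>) * \<delta> B" if B: "B \<in> orbits \<Gamma> (verts G) \<phi>" for B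
  proof -
    have *: "w \<in> verts G \<and> orbit \<Gamma> \<phi> w = B" if "w \<in> B" for w
      using B that orbit_eq element_image by (fastforce simp: orbits_def orbit_def)
    have "(\<Sum>v\<in>B. f v) = (\<Sum>v\<in>B. int (card (stabilizer \<Gamma> \<phi> v)) * \<delta> B)"
      by (rule sum.cong) (auto simp: \<delta>(1) pullback_def *)
    also have "\<dots> = int (\<Sum>v\<in>B. card (stabilizer \<Gamma> \<phi> v)) * \<delta> B"
      by (simp add: sum_distrib_right)
    finally show ?thesis using card_stablizer_sum[OF assms(3) B] by simp
  qed
  then have "(\<Sum>B\<in>orbits \<Gamma> (verts G) \<phi>. \<Sum>v\<in>B. f v) = int (order \<Gamma>) * d"
    by (simp add: \<delta>(2)[symmetric] sum_distrib_left)
  then show ?thesis using disjoint_sum[OF assms(2), of f] by simp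
qed

text \<open>Points of a common orbit have stabilizers of equal size: either size times the size of
  that orbit is the order of the group.\<close>

lemma pullbacks_deg_invariant:
  assumes "group_action \<Gamma> (verts G) \<phi>" and "finite (verts G)" and "finite (carrier \<Gamma>)"
    and "f \<in> pullbacks_deg \<Gamma> G \<phi> d" and "g \<in> carrier \<Gamma>" and "v \<in> verts G"
  shows "f (\<phi> g v) = f v"
proof -
  interpret group_action \<Gamma> "verts G" \<phi> by fact
  have gv: "\<phi> g v \<in> verts G" "\<phi> g v \<in> orbit \<Gamma> \<phi> v"
    using assms(5,6) element_image by (auto simp: orbit_def)
  have "orbit \<Gamma> \<phi> (\<phi> g v) = orbit \<Gamma> \<phi> v" using orbit_eq[OF assms(6) gv(2)] .
  moreover have "card (stabilizer \<Gamma> \<phi> (\<phi> g v)) = card (stabilizer \<Gamma> \<phi> v)"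
  proof -
    have "card (orbit \<Gamma> \<phi> v) > 0"
      using orbit_refl[OF assms(6)] assms(3) by (auto simp: orbit_def card_gt_0_iff)
    then show ?thesis
      using orbit_stabilizer_theorem[OF gv(1)] orbit_stabilizer_theorem[OF assms(6)] calculation
      by (metis mult_cancel1 less_not_refl)
  qed
  ultimately show ?thesis
    using assms(4,6) gv by (auto simp: pullbacks_deg_def pullback_def)
qed

section \<open>Dihedral groups\<close>

lemma (in group) carrier_subgroup_generated_involution:
  assumes "\<sigma> \<in> carrier G" and "\<sigma> \<otimes> \<sigma> = \<one>"
  shows "carrier (subgroup_generated G {\<sigma>}) = {\<one>, \<sigma>}"
proof -
  have "inv \<sigma> = \<sigma>" using assms by (simp add: inv_equality)
  then have "subgroup {\<one>, \<sigma>} G"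
    using assms by (intro subgroupI) auto
  then have "carrier (subgroup_generated G {\<sigma>}) \<subseteq> {\<one>, \<sigma>}"
    by (intro subgroup_generated_minimal) auto
  then show ?thesis
    using assms by (auto simp: carrier_subgroup_generated intro: generate.intros)
qed

text \<open>The rotation subgroup \<open>H\<close> and its coset \<open>?K\<close> by
  \<open>\<sigma>\<^sub>1\<close> are disjoint, equally large and cover the group, which has
  \<open>2 * n\<close> elements.\<close>

lemma order_rotation_subgroup:
  assumes "dihedral_group D n \<sigma>\<^sub>1 \<sigma>\<^sub>2" and "n > 0"
  shows "order (subgroup_generated D {\<sigma>\<^sub>1 \<otimes>\<^bsub>D\<^esub> \<sigma>\<^sub>2}) = n"
proof -
  interpret group D using assms(1) by (simp add: dihedral_group_def)
  note D = assms(1)[unfolded dihedral_group_def]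
  have c: "\<sigma>\<^sub>1 \<in> carrier D" "\<sigma>\<^sub>2 \<in> carrier D" and sq: "\<sigma>\<^sub>1 \<otimes>\<^bsub>D\<^esub> \<sigma>\<^sub>1 = \<one>\<^bsub>D\<^esub>" "\<sigma>\<^sub>2 \<otimes>\<^bsub>D\<^esub> \<sigma>\<^sub>2 = \<one>\<^bsub>D\<^esub>"
    using D by auto
  define \<rho> where "\<rho> = \<sigma>\<^sub>1 \<otimes>\<^bsub>D\<^esub> \<sigma>\<^sub>2"
  have \<rho>: "\<rho> \<in> carrier D" using c by (simp add: \<rho>_def)
  define H where "H = carrier (subgroup_generated D {\<rho>})"
  have H_pow: "H = range (\<lambda>k::int. \<rho> [^]\<^bsub>D\<^esub> k)"
    unfolding H_def by (rule carrier_subgroup_generated_by_singleton[OF \<rho>])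
  have subH: "subgroup H D"
    unfolding H_def carrier_subgroup_generated by (rule generate_is_subgroup) auto
  have H_car: "H \<subseteq> carrier D" using subH by (rule subgroup.subset)
  have inv: "inv\<^bsub>D\<^esub> \<sigma>\<^sub>1 = \<sigma>\<^sub>1" "inv\<^bsub>D\<^esub> \<sigma>\<^sub>2 = \<sigma>\<^sub>2"
    using c sq by (simp_all add: inv_equality)
  have inv_\<rho>: "inv\<^bsub>D\<^esub> \<rho> = \<sigma>\<^sub>2 \<otimes>\<^bsub>D\<^esub> \<sigma>\<^sub>1"
    using c by (simp add: \<rho>_def inv_mult_group inv)
  have \<rho>_H: "\<rho> \<in> H" unfolding H_def using \<rho> by (auto simp: carrier_subgroup_generated intro: generate.incl)
  have conj_\<rho>: "\<sigma>\<^sub>1 \<otimes>\<^bsub>D\<^esub> \<rho> \<otimes>\<^bsub>D\<^esub> \<sigma>\<^sub>1 = inv\<^bsub>D\<^esub> \<rho>"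
    unfolding inv_\<rho> using c sq by (simp add: \<rho>_def m_assoc[symmetric])
  \<comment> \<open>Powers of \<open>\<rho>\<close> commute with \<open>\<rho>\<close>, while
    conjugation by \<open>\<sigma>\<^sub>1\<close> inverts it. So
    \<open>\<sigma>\<^sub>1 \<in> H\<close> would make \<open>\<rho>\<close> an involution or
    trivial, leaving only \<open>\<sigma>\<^sub>1 = \<rho>\<close>, that is,
    \<open>\<sigma>\<^sub>2\<close> trivial.\<close>
  have s1_notin: "\<sigma>\<^sub>1 \<notin> H"
  proof
    assume "\<sigma>\<^sub>1 \<in> H"
    then obtain k :: int where k: "\<sigma>\<^sub>1 = \<rho> [^]\<^bsub>D\<^esub> k" using H_pow by auto
    have "\<sigma>\<^sub>1 \<otimes>\<^bsub>D\<^esub> \<rho> = \<rho> \<otimes>\<^bsub>D\<^esub> \<sigma>\<^sub>1"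
      unfolding k using \<rho> int_pow_mult[of \<rho> k 1] int_pow_mult[of \<rho> 1 k] by (simp add: add.commute)
    then have "\<sigma>\<^sub>1 \<otimes>\<^bsub>D\<^esub> \<rho> \<otimes>\<^bsub>D\<^esub> \<sigma>\<^sub>1 = \<rho>"
      using c \<rho> sq by (simp add: m_assoc)
    then have "inv\<^bsub>D\<^esub> \<rho> = \<rho>" using conj_\<rho> by simp
    then have "\<rho> \<otimes>\<^bsub>D\<^esub> \<rho> = \<one>\<^bsub>D\<^esub>" using \<rho> by (metis r_inv)
    then have "H = {\<one>\<^bsub>D\<^esub>, \<rho>}"
      unfolding H_def using \<rho> by (rule carrier_subgroup_generated_involution[rotated])
    then have "\<sigma>\<^sub>1 = \<rho>" using \<open>\<sigma>\<^sub>1 \<in> H\<close> D by auto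
    then have "\<sigma>\<^sub>2 = \<one>\<^bsub>D\<^esub>" using c by (simp add: \<rho>_def)
    then show False using D by simp
  qed
  have s1_pow: "\<sigma>\<^sub>1 \<otimes>\<^bsub>D\<^esub> h \<otimes>\<^bsub>D\<^esub> \<sigma>\<^sub>1 \<in> H" if "h \<in> H" for h
  proof -
    have "(\<lambda>g. \<sigma>\<^sub>1 \<otimes>\<^bsub>D\<^esub> g \<otimes>\<^bsub>D\<^esub> \<sigma>\<^sub>1) ` generate D {\<rho>} \<subseteq> H"
    proof safe
      fix g assume "g \<in> generate D {\<rho>}"
      then show "\<sigma>\<^sub>1 \<otimes>\<^bsub>D\<^esub> g \<otimes>\<^bsub>D\<^esub> \<sigma>\<^sub>1 \<in> H"
      proof induction
        case one
        then show ?case using c sq subH by (simp add: subgroup.one_closed)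
      next
        case (incl h)
        then show ?case using conj_\<rho> \<rho>_H subH by (simp add: subgroup.m_inv_closed)
      next
        case (inv h)
        have "\<sigma>\<^sub>1 \<otimes>\<^bsub>D\<^esub> inv\<^bsub>D\<^esub> \<rho> \<otimes>\<^bsub>D\<^esub> \<sigma>\<^sub>1 = \<rho>"
          unfolding inv_\<rho> using c sq by (simp add: m_assoc[symmetric]) (simp add: m_assoc \<rho>_def)
        then show ?case using inv \<rho>_H by simp
      next
        case (eng a b)
        have ab: "a \<in> carrier D" "b \<in> carrier D"
          using eng(1,2) generate_in_carrier[of "{\<rho>}"] \<rho> by auto
        have "\<sigma>\<^sub>1 \<otimes>\<^bsub>D\<^esub> (\<sigma>\<^sub>1 \<otimes>\<^bsub>D\<^esub> w) = w" if "w \<in> carrier D" for w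
          using c sq that by (simp add: m_assoc[symmetric])
        then have "\<sigma>\<^sub>1 \<otimes>\<^bsub>D\<^esub> (a \<otimes>\<^bsub>D\<^esub> b) \<otimes>\<^bsub>D\<^esub> \<sigma>\<^sub>1
            = (\<sigma>\<^sub>1 \<otimes>\<^bsub>D\<^esub> a \<otimes>\<^bsub>D\<^esub> \<sigma>\<^sub>1) \<otimes>\<^bsub>D\<^esub> (\<sigma>\<^sub>1 \<otimes>\<^bsub>D\<^esub> b \<otimes>\<^bsub>D\<^esub> \<sigma>\<^sub>1)"
          using ab c by (simp add: m_assoc)
        then show ?case using eng subH by (simp add: subgroup.m_closed)
      qed
    qed
    then show ?thesis using that \<rho> by (auto simp: H_def carrier_subgroup_generated)
  qed
  let ?K = "(\<lambda>h. h \<otimes>\<^bsub>D\<^esub> \<sigma>\<^sub>1) ` H"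
  \<comment> \<open>The union contains both generators. It is closed under products because moving
    \<open>\<sigma>\<^sub>1\<close> past an element of \<open>H\<close> conjugates that element,
    which stays in \<open>H\<close> by \<open>s1_pow\<close>.\<close>
  have "carrier D = H \<union> ?K"
  proof
    have "generate D {\<sigma>\<^sub>1, \<sigma>\<^sub>2} \<subseteq> H \<union> ?K"
    proof
      fix g assume "g \<in> generate D {\<sigma>\<^sub>1, \<sigma>\<^sub>2}"
      moreover have gens: "\<sigma>\<^sub>1 \<in> ?K" "\<sigma>\<^sub>2 \<in> ?K"
      proof -
        have "\<sigma>\<^sub>1 = \<one>\<^bsub>D\<^esub> \<otimes>\<^bsub>D\<^esub> \<sigma>\<^sub>1" "\<sigma>\<^sub>2 = inv\<^bsub>D\<^esub> \<rho> \<otimes>\<^bsub>D\<^esub> \<sigma>\<^sub>1"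
          using c sq by (simp_all add: inv_\<rho> m_assoc)
        moreover have "\<one>\<^bsub>D\<^esub> \<in> H" "inv\<^bsub>D\<^esub> \<rho> \<in> H"
          using subH \<rho>_H by (simp_all add: subgroup.one_closed subgroup.m_inv_closed)
        ultimately show "\<sigma>\<^sub>1 \<in> ?K" "\<sigma>\<^sub>2 \<in> ?K" by blast+
      qed
      ultimately show "g \<in> H \<union> ?K"
      proof induction
        case one
        then show ?case using subH by (simp add: subgroup.one_closed)
      next
        case (incl h)
        then show ?case by blast
      next
        case (inv h)
        then show ?case using \<open>inv\<^bsub>D\<^esub> \<sigma>\<^sub>1 = \<sigma>\<^sub>1\<close> \<open>inv\<^bsub>D\<^esub> \<sigma>\<^sub>2 = \<sigma>\<^sub>2\<close> by auto
      next
        case (eng a b)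
        have mc: "h \<otimes>\<^bsub>D\<^esub> k \<in> H" if "h \<in> H" "k \<in> H" for h k
          using subH that by (rule subgroup.m_closed)
        have a: "a \<in> H \<union> ?K" and b: "b \<in> H \<union> ?K" using eng gens by auto
        from a show ?case
        proof
          assume a: "a \<in> H"
          from b show ?thesis
          proof
            assume "b \<in> ?K"
            then obtain k where k: "k \<in> H" "b = k \<otimes>\<^bsub>D\<^esub> \<sigma>\<^sub>1" by auto
            then have "a \<otimes>\<^bsub>D\<^esub> b = (a \<otimes>\<^bsub>D\<^esub> k) \<otimes>\<^bsub>D\<^esub> \<sigma>\<^sub>1"
              using a H_car c by (simp add: m_assoc subset_iff)
            then show ?thesis using mc[OF a k(1)] by blast
          qed (use a mc in blast)
        next
          assume "a \<in> ?K"
          then obtain h where h: "h \<in> H" "a = h \<otimes>\<^bsub>D\<^esub> \<sigma>\<^sub>1" by auto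
          from b show ?thesis
          proof
            assume b: "b \<in> H"
            have "a \<otimes>\<^bsub>D\<^esub> b = (h \<otimes>\<^bsub>D\<^esub> (\<sigma>\<^sub>1 \<otimes>\<^bsub>D\<^esub> b \<otimes>\<^bsub>D\<^esub> \<sigma>\<^sub>1)) \<otimes>\<^bsub>D\<^esub> \<sigma>\<^sub>1"
              using h b H_car c sq by (simp add: m_assoc subset_iff)
            then show ?thesis using mc[OF h(1) s1_pow[OF b]] by blast
          next
            assume "b \<in> ?K"
            then obtain k where k: "k \<in> H" "b = k \<otimes>\<^bsub>D\<^esub> \<sigma>\<^sub>1" by auto
            have "a \<otimes>\<^bsub>D\<^esub> b = h \<otimes>\<^bsub>D\<^esub> (\<sigma>\<^sub>1 \<otimes>\<^bsub>D\<^esub> k \<otimes>\<^bsub>D\<^esub> \<sigma>\<^sub>1)"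
              using h k H_car c by (simp add: m_assoc subset_iff)
            then show ?thesis using mc[OF h(1) s1_pow[OF k(1)]] by simp
          qed
        qed
      qed
    qed
    then show "carrier D \<subseteq> H \<union> ?K" using D by simp
    show "H \<union> ?K \<subseteq> carrier D" using H_car c by auto
  qed
  moreover have "H \<inter> ?K = {}"
  proof (rule ccontr)
    assume "H \<inter> ?K \<noteq> {}"
    then obtain h where h: "h \<in> H" "h \<otimes>\<^bsub>D\<^esub> \<sigma>\<^sub>1 \<in> H" by auto
    then have "inv\<^bsub>D\<^esub> h \<otimes>\<^bsub>D\<^esub> (h \<otimes>\<^bsub>D\<^esub> \<sigma>\<^sub>1) \<in> H"
      using subH by (simp add: subgroup.m_closed subgroup.m_inv_closed)
    then show False using s1_notin h H_car c by (simp add: m_assoc[symmetric] subset_iff)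
  qed
  moreover have "card ?K = card H"
    using H_car c by (intro card_image inj_onI) (metis right_cancel subsetD)
  moreover have "finite (carrier D)"
    using D \<open>n > 0\<close> by (auto simp: order_def intro: card_ge_0_finite)
  ultimately have "2 * card H = 2 * n"
    using D by (metis card_Un_disjoint finite_Un mult_2 order_def)
  then show ?thesis
    by (simp add: order_def H_def \<rho>_def)
qed

section \<open>Labelled graphs\<close>

locale dihedral_labelled_graph =
  fixes D :: "('g, 'm) monoid_scheme" and n :: nat and \<sigma>\<^sub>1 \<sigma>\<^sub>2 :: 'g
    and G :: "('v, 'e) multigraph"
    and \<phi> :: "'g \<Rightarrow> 'v \<Rightarrow> 'v"
    and s t :: nat and z x y :: "int \<Rightarrow> nat \<Rightarrow> 'v"
  assumes odd_n: "odd n"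
    and dihedral: "dihedral_group D n \<sigma>\<^sub>1 \<sigma>\<^sub>2"
    and finite_verts: "finite (verts G)" and verts_nonempty: "verts G \<noteq> {}"
    and action: "group_action D (verts G) \<phi>"
    and orbit_sizes: "\<forall>B\<in>orbits D (verts G) \<phi>. card B = n \<or> card B = 2 * n"
    and labelling: "dihedral_labelling D n \<sigma>\<^sub>1 \<sigma>\<^sub>2 G \<phi> s t z x y"
begin

lemma n_pos: "n > 0"
  using odd_n by (rule odd_pos)

sublocale group D
  using dihedral by (simp add: dihedral_group_def)

sublocale act: group_action D "verts G" \<phi>
  by (rule action)

abbreviation "\<Gamma>\<^sub>1 \<equiv> subgroup_generated D {\<sigma>\<^sub>1}"
abbreviation "\<Gamma>\<^sub>2 \<equiv> subgroup_generated D {\<sigma>\<^sub>2}"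
abbreviation "\<Gamma>\<^sub>3 \<equiv> subgroup_generated D {\<sigma>\<^sub>1 \<otimes>\<^bsub>D\<^esub> \<sigma>\<^sub>2}"

lemma involutions:
  "\<sigma>\<^sub>1 \<in> carrier D" "\<sigma>\<^sub>2 \<in> carrier D"
  "\<sigma>\<^sub>1 \<otimes>\<^bsub>D\<^esub> \<sigma>\<^sub>1 = \<one>\<^bsub>D\<^esub>" "\<sigma>\<^sub>2 \<otimes>\<^bsub>D\<^esub> \<sigma>\<^sub>2 = \<one>\<^bsub>D\<^esub>"
  "\<sigma>\<^sub>1 \<noteq> \<one>\<^bsub>D\<^esub>" "\<sigma>\<^sub>2 \<noteq> \<one>\<^bsub>D\<^esub>"
  using dihedral by (auto simp: dihedral_group_def)

lemma finite_carrier: "finite (carrier D)"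
  using dihedral n_pos by (auto simp: dihedral_group_def order_def intro: card_ge_0_finite)

lemma generated_action: "group_action (subgroup_generated D S) (verts G) \<phi>"
  unfolding subgroup_generated_def
  by (rule act.induced_action) (simp add: generate_is_subgroup)

lemma finite_generated: "finite (carrier (subgroup_generated D S))"
  using finite_carrier carrier_subgroup_generated_subset finite_subset by blast

lemmas generated_degree = pullbacks_deg_degree[OF generated_action finite_verts finite_generated]
lemmas generated_invariant = pullbacks_deg_invariant[OF generated_action finite_verts finite_generated]
lemmas generated_orbit = pullbacks_deg_orbit[OF generated_action finite_verts]

lemma order_generated: "order \<Gamma>\<^sub>1 = 2" "order \<Gamma>\<^sub>2 = 2" "order \<Gamma>\<^sub>3 = n"
  using involutions order_rotation_subgroup[OF dihedral n_pos]
  by (auto simp: order_def carrier_subgroup_generated_involution)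

text \<open>An orbit of size \<open>n\<close> is treated as a strand paired with itself, \<open>p = q = z\<^sup>j\<close>.\<close>

definition strands :: "(int \<Rightarrow> 'v) \<Rightarrow> (int \<Rightarrow> 'v) \<Rightarrow> bool" where
  "strands p q \<longleftrightarrow>
     inj_on p {1..int n} \<and> inj_on q {1..int n} \<and>
     (\<forall>i. p i \<in> verts G \<and> q i \<in> verts G \<and>
        p (i + int n) = p i \<and> q (i + int n) = q i \<and>
        \<phi> \<sigma>\<^sub>1 (p i) = q (1 - i) \<and> \<phi> \<sigma>\<^sub>1 (q i) = p (1 - i) \<and>
        \<phi> \<sigma>\<^sub>2 (p i) = q (2 - i) \<and> \<phi> \<sigma>\<^sub>2 (q i) = p (2 - i))"

lemma strands_sym: "strands p q \<Longrightarrow> strands q p"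
  by (auto simp: strands_def)

lemma periodic_range:
  assumes "\<And>i. p (i + int n) = p i"
  shows "p i \<in> p ` {1..int n}"
proof -
  have "p i = p ((i - 1) mod int n + 1)"
    by (rule periodic_mod[where p=p])
       (use assms in \<open>auto simp: cong_def mod_simps\<close>)
  moreover have "(i - 1) mod int n + 1 \<in> {1..int n}"
    using n_pos by (simp add: add1_zle_eq)
  ultimately show ?thesis by blast
qed

section \<open>Vertices enumerated by the labelling\<close>

lemma z_orbit:
  assumes "j \<in> {1..s}"
  shows "(\<lambda>i. z i j) ` {1..int n} \<in> orbits D (verts G) \<phi>" "card ((\<lambda>i. z i j) ` {1..int n}) = n"
proof -
  have "{z i j | i. i \<in> {1..int n}} \<in> {B \<in> orbits D (verts G) \<phi>. card B = n}"
    using labelling[unfolded dihedral_labelling_def] assms by (blast dest: bij_betw_apply)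
  moreover have "{z i j | i. i \<in> {1..int n}} = (\<lambda>i. z i j) ` {1..int n}" by auto
  ultimately show "(\<lambda>i. z i j) ` {1..int n} \<in> orbits D (verts G) \<phi>"
    "card ((\<lambda>i. z i j) ` {1..int n}) = n" by auto
qed

lemma xy_orbit:
  assumes "j \<in> {1..t}"
  shows "(\<lambda>i. x i j) ` {1..int n} \<union> (\<lambda>i. y i j) ` {1..int n} \<in> orbits D (verts G) \<phi>"
    "card ((\<lambda>i. x i j) ` {1..int n} \<union> (\<lambda>i. y i j) ` {1..int n}) = 2 * n"
proof -
  have "{x i j | i. i \<in> {1..int n}} \<union> {y i j | i. i \<in> {1..int n}}
      \<in> {B \<in> orbits D (verts G) \<phi>. card B = 2 * n}"
    using labelling[unfolded dihedral_labelling_def] assms by (blast dest: bij_betw_apply)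
  moreover have "{x i j | i. i \<in> {1..int n}} = (\<lambda>i. x i j) ` {1..int n}"
    "{y i j | i. i \<in> {1..int n}} = (\<lambda>i. y i j) ` {1..int n}" by auto
  ultimately show "(\<lambda>i. x i j) ` {1..int n} \<union> (\<lambda>i. y i j) ` {1..int n} \<in> orbits D (verts G) \<phi>"
    "card ((\<lambda>i. x i j) ` {1..int n} \<union> (\<lambda>i. y i j) ` {1..int n}) = 2 * n" by auto
qed

text \<open>Counting: each family gives at most \<open>n\<close> vertices, and together they give
  \<open>2 * n\<close>, so nothing may coincide.\<close>

lemma xy_inj:
  assumes "j \<in> {1..t}"
  shows "inj_on (\<lambda>i. x i j) {1..int n}" "inj_on (\<lambda>i. y i j) {1..int n}"
    "(\<lambda>i. x i j) ` {1..int n} \<inter> (\<lambda>i. y i j) ` {1..int n} = {}"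
proof -
  let ?X = "(\<lambda>i. x i j) ` {1..int n}" and ?Y = "(\<lambda>i. y i j) ` {1..int n}"
  have "card ?X \<le> n" "card ?Y \<le> n"
    using card_image_le[of "{1..int n}"] by force+
  moreover have "card ?X + card ?Y = card (?X \<union> ?Y) + card (?X \<inter> ?Y)"
    by (rule card_Un_Int) auto
  ultimately have "card ?X = n" "card ?Y = n" "card (?X \<inter> ?Y) = 0"
    using xy_orbit(2)[OF assms] by linarith+
  then show "inj_on (\<lambda>i. x i j) {1..int n}" "inj_on (\<lambda>i. y i j) {1..int n}" "?X \<inter> ?Y = {}"
    by (auto intro: eq_card_imp_inj_on)
qed

lemma strands_z:
  assumes j: "j \<in> {1..s}"
  shows "strands (\<lambda>i. z i j) (\<lambda>i. z i j)"
proof -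
  have per: "z (i + int n) j = z i j" and
    act: "\<phi> \<sigma>\<^sub>1 (z i j) = z (int n + 1 - i) j" "\<phi> \<sigma>\<^sub>2 (z i j) = z (int n + 2 - i) j" for i
    using labelling j by (auto simp: dihedral_labelling_def)
  have "z (int n + 1 - i) j = z (1 - i) j" "z (int n + 2 - i) j = z (2 - i) j" for i
    using per[of "1 - i"] per[of "2 - i"] by (simp_all add: algebra_simps)
  moreover have "inj_on (\<lambda>i. z i j) {1..int n}"
    using z_orbit(2)[OF j] by (auto intro: eq_card_imp_inj_on)
  moreover have "z i j \<in> verts G" for i
    using periodic_range[of "\<lambda>i. z i j"] per z_orbit(1)[OF j] act.orbits_coverture by blast
  ultimately show ?thesis using per act by (simp add: strands_def)
qed

lemma strands_xy:
  assumes j: "j \<in> {1..t}"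
  shows "strands (\<lambda>i. x i j) (\<lambda>i. y i j)"
proof -
  have per: "x (i + int n) j = x i j" "y (i + int n) j = y i j" and
    act: "\<phi> \<sigma>\<^sub>1 (x i j) = y (int n + 1 - i) j" "\<phi> \<sigma>\<^sub>2 (x i j) = y (int n + 2 - i) j"
      "\<phi> \<sigma>\<^sub>1 (y i j) = x (int n + 1 - i) j" "\<phi> \<sigma>\<^sub>2 (y i j) = x (int n + 2 - i) j" for i
    using labelling j by (auto simp: dihedral_labelling_def)
  have "x (int n + 1 - i) j = x (1 - i) j" "x (int n + 2 - i) j = x (2 - i) j"
    "y (int n + 1 - i) j = y (1 - i) j" "y (int n + 2 - i) j = y (2 - i) j" for i
    using per[of "1 - i"] per[of "2 - i"] by (simp_all add: algebra_simps)
  moreover have "x i j \<in> verts G" "y i j \<in> verts G" for i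
    using periodic_range[of "\<lambda>i. x i j"] periodic_range[of "\<lambda>i. y i j"]
      per xy_orbit(1)[OF j] act.orbits_coverture by blast+
  ultimately show ?thesis using per act xy_inj[OF j] by (simp add: strands_def)
qed

text \<open>The orbits partition the vertices, and each has size \<open>n\<close> or
  \<open>2 * n\<close>, distinct numbers since \<open>n > 0\<close>. The labelling enumerates the
  orbits of either size and the vertices in each.\<close>

lemma sum_verts:
  fixes F :: "'v \<Rightarrow> int"
  shows "(\<Sum>v\<in>verts G. F v) =
    (\<Sum>j=1..s. \<Sum>i=1..int n. F (z i j)) + (\<Sum>j=1..t. \<Sum>i=1..int n. F (x i j) + F (y i j))"
proof -
  let ?O = "orbits D (verts G) \<phi>"
  let ?Z = "\<lambda>j. {z i j | i. i \<in> {1..int n}}"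
  let ?XY = "\<lambda>j. {x i j | i. i \<in> {1..int n}} \<union> {y i j | i. i \<in> {1..int n}}"
  have bij: "bij_betw ?Z {1..s} {B \<in> ?O. card B = n}" "bij_betw ?XY {1..t} {B \<in> ?O. card B = 2 * n}"
    using labelling by (auto simp: dihedral_labelling_def)
  have O: "?O = {B \<in> ?O. card B = n} \<union> {B \<in> ?O. card B = 2 * n}"
    using orbit_sizes by auto
  have "(\<Sum>v\<in>verts G. F v) = (\<Sum>B\<in>?O. \<Sum>v\<in>B. F v)"
    by (rule act.disjoint_sum[OF finite_verts, symmetric])
  also have "\<dots> = (\<Sum>B\<in>{B \<in> ?O. card B = n}. \<Sum>v\<in>B. F v)
      + (\<Sum>B\<in>{B \<in> ?O. card B = 2 * n}. \<Sum>v\<in>B. F v)"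
  proof (subst O, rule sum.union_disjoint)
    have "finite ?O" using finite_verts by (simp add: orbits_def)
    then show "finite {B \<in> ?O. card B = n}" "finite {B \<in> ?O. card B = 2 * n}" by auto
    show "{B \<in> ?O. card B = n} \<inter> {B \<in> ?O. card B = 2 * n} = {}" using n_pos by auto
  qed
  also have "(\<Sum>B\<in>{B \<in> ?O. card B = n}. \<Sum>v\<in>B. F v) = (\<Sum>j=1..s. \<Sum>v\<in>?Z j. F v)"
    by (rule sum.reindex_bij_betw[OF bij(1), symmetric])
  also have "\<dots> = (\<Sum>j=1..s. \<Sum>i=1..int n. F (z i j))"
  proof (rule sum.cong[OF refl])
    fix j assume j: "j \<in> {1..s}"
    have "?Z j = (\<lambda>i. z i j) ` {1..int n}" by auto
    then show "(\<Sum>v\<in>?Z j. F v) = (\<Sum>i=1..int n. F (z i j))"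
      using strands_z[OF j] by (simp add: strands_def sum.reindex)
  qed
  also have "(\<Sum>B\<in>{B \<in> ?O. card B = 2 * n}. \<Sum>v\<in>B. F v) = (\<Sum>j=1..t. \<Sum>v\<in>?XY j. F v)"
    by (rule sum.reindex_bij_betw[OF bij(2), symmetric])
  also have "\<dots> = (\<Sum>j=1..t. \<Sum>i=1..int n. F (x i j) + F (y i j))"
  proof (rule sum.cong[OF refl])
    fix j assume j: "j \<in> {1..t}"
    have "?XY j = (\<lambda>i. x i j) ` {1..int n} \<union> (\<lambda>i. y i j) ` {1..int n}" by auto
    then show "(\<Sum>v\<in>?XY j. F v) = (\<Sum>i=1..int n. F (x i j) + F (y i j))"
      using xy_inj[OF j] by (simp add: sum.union_disjoint sum.reindex sum.distrib)
  qed
  finally show ?thesis .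
qed

section \<open>Weights of pullbacks\<close>

definition weight :: "('v \<Rightarrow> int) \<Rightarrow> int" where
  "weight f = (\<Sum>i=1..int n. i * ((\<Sum>j=1..t. f (x i j)) + (\<Sum>j=1..t. f (y i j)) + (\<Sum>j=1..s. f (z i j))))"

text \<open>Summing orbit by orbit lets the symmetries be studied on one pair of strands at a
  time.\<close>

lemma weight_alt:
  "weight f = (\<Sum>j=1..s. \<Sum>i=1..int n. i * f (z i j))
     + (\<Sum>j=1..t. (\<Sum>i=1..int n. i * f (x i j)) + (\<Sum>i=1..int n. i * f (y i j)))"
proof -
  have "(\<Sum>j=1..s. \<Sum>i=1..int n. i * f (z i j)) = (\<Sum>i=1..int n. \<Sum>j=1..s. i * f (z i j))"
    "(\<Sum>j=1..t. \<Sum>i=1..int n. i * f (x i j)) = (\<Sum>i=1..int n. \<Sum>j=1..t. i * f (x i j))"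
    "(\<Sum>j=1..t. \<Sum>i=1..int n. i * f (y i j)) = (\<Sum>i=1..int n. \<Sum>j=1..t. i * f (y i j))"
    by (rule sum.swap)+
  then show ?thesis
    by (simp add: weight_def distrib_left sum.distrib sum_distrib_left)
qed

lemma weight_add: "weight (\<lambda>v. f v + g v + h v) = weight f + weight g + weight h"
  by (simp add: weight_alt distrib_left sum.distrib)

text \<open>Substituting \<open>c - i\<close> for \<open>i\<close> turns the weighted sum over
  \<open>q\<close> into the sum of \<open>(c - i) * f (p i)\<close>, whose weighted part cancels
  against the sum over \<open>p\<close>. What remains is \<open>c\<close> times the plain sum over
  \<open>p\<close>, which is half of the sum over both strands.\<close>

lemma strand_weight_reflect:
  fixes f :: "'v \<Rightarrow> int"
  assumes "strands p q" and refl: "\<And>i. f (q (c - i)) = f (p i)"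
  shows "[2 * ((\<Sum>i=1..int n. i * f (p i)) + (\<Sum>i=1..int n. i * f (q i)))
       = c * (\<Sum>i=1..int n. f (p i) + f (q i))] (mod int n)"
    and "(\<Sum>i=1..int n. f (q i)) = (\<Sum>i=1..int n. f (p i))"
proof -
  have per: "f (q (i + int n)) = f (q i)" for i
    using assms(1) by (simp add: strands_def)
  have "[(\<Sum>i=1..int n. i * f (q i)) = (\<Sum>i=1..int n. (c - i) * f (q (c - i)))] (mod int n)"
    using weighted_sum_periodic_reflect[of "\<lambda>i. f (q i)" n c] per n_pos by (simp add: cong_sym)
  also have "(\<Sum>i=1..int n. (c - i) * f (q (c - i))) = c * (\<Sum>i=1..int n. f (p i)) - (\<Sum>i=1..int n. i * f (p i))"
    by (simp add: refl left_diff_distrib sum_subtractf sum_distrib_left)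
  finally have Q: "[(\<Sum>i=1..int n. i * f (p i)) + (\<Sum>i=1..int n. i * f (q i)) = c * (\<Sum>i=1..int n. f (p i))] (mod int n)"
    by (simp add: cong_iff_dvd_diff algebra_simps)
  show eq: "(\<Sum>i=1..int n. f (q i)) = (\<Sum>i=1..int n. f (p i))"
    using sum_periodic_reflect[of "\<lambda>i. f (q i)" n c] per n_pos by (simp add: refl)
  show "[2 * ((\<Sum>i=1..int n. i * f (p i)) + (\<Sum>i=1..int n. i * f (q i)))
       = c * (\<Sum>i=1..int n. f (p i) + f (q i))] (mod int n)"
    using cong_scalar_left[OF Q, of 2] eq by (simp add: sum.distrib algebra_simps)
qed

lemma weight_reflect:
  assumes "\<And>p q i. strands p q \<Longrightarrow> f (q (c - i)) = f (p i)"
  shows "[2 * weight f = c * (\<Sum>v\<in>verts G. f v)] (mod int n)"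
proof -
  have "[2 * (\<Sum>j=1..s. \<Sum>i=1..int n. i * f (z i j)) = c * (\<Sum>j=1..s. \<Sum>i=1..int n. f (z i j))] (mod int n)"
    unfolding sum_distrib_left[of _ _ "{1..s}"]
  proof (rule cong_sum)
    fix j assume "j \<in> {1..s}"
    note z = strands_z[OF this]
    \<comment> \<open>Here the two strands coincide, so every vertex is counted twice. The extra
      factor 2 can be cancelled because \<open>n\<close> is odd.\<close>
    have "[2 * (2 * (\<Sum>i=1..int n. i * f (z i j))) = c * (\<Sum>i=1..int n. f (z i j) + f (z i j))] (mod int n)"
      using strand_weight_reflect(1)[OF z assms[OF z]] by simp
    also have "c * (\<Sum>i=1..int n. f (z i j) + f (z i j)) = 2 * (c * (\<Sum>i=1..int n. f (z i j)))"
      by (simp only: sum.distrib) simp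
    finally have "[2 * (2 * (\<Sum>i=1..int n. i * f (z i j))) = 2 * (c * (\<Sum>i=1..int n. f (z i j)))] (mod int n)" .
    then show "[2 * (\<Sum>i=1..int n. i * f (z i j)) = c * (\<Sum>i=1..int n. f (z i j))] (mod int n)"
      using odd_n by (subst (asm) cong_mult_lcancel) (auto simp: coprime_commute)
  qed
  moreover have "[2 * (\<Sum>j=1..t. (\<Sum>i=1..int n. i * f (x i j)) + (\<Sum>i=1..int n. i * f (y i j)))
      = c * (\<Sum>j=1..t. \<Sum>i=1..int n. f (x i j) + f (y i j))] (mod int n)"
    unfolding sum_distrib_left[of _ _ "{1..t}"]
    by (intro cong_sum strand_weight_reflect(1) strands_xy assms)
  ultimately show ?thesis
    unfolding weight_alt sum_verts distrib_left by (rule cong_add)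
qed

section \<open>The action along a strand\<close>

lemma strand_act:
  assumes "strands p q"
  shows "p i \<in> verts G" "\<phi> \<sigma>\<^sub>1 (p i) = q (1 - i)" "\<phi> \<sigma>\<^sub>2 (p i) = q (2 - i)"
    "\<phi> (\<sigma>\<^sub>1 \<otimes>\<^bsub>D\<^esub> \<sigma>\<^sub>2) (p i) = p (i - 1)"
  \<comment> \<open>Two reflections compose to a shift of the index:
    \<open>1 - (2 - i) = i - 1\<close>.\<close>
  using assms involutions act.composition_rule[of "p i" \<sigma>\<^sub>1 \<sigma>\<^sub>2]
  by (auto simp: strands_def)

lemma generator_mem: "g \<in> carrier D \<Longrightarrow> g \<in> carrier (subgroup_generated D {g})"
  by (simp add: carrier_subgroup_generated generate.incl)

lemma rotation_pow:
  assumes "strands p q"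
  shows "\<phi> ((\<sigma>\<^sub>1 \<otimes>\<^bsub>D\<^esub> \<sigma>\<^sub>2) [^]\<^bsub>D\<^esub> k) (p i) = p (i - int k)"
proof (induction k arbitrary: i)
  case 0
  have "\<phi> \<one>\<^bsub>D\<^esub> (p i) = p i"
    using act.id_eq_one strand_act(1)[OF assms] by (metis restrict_apply')
  then show ?case by simp
next
  case (Suc k)
  have "\<phi> ((\<sigma>\<^sub>1 \<otimes>\<^bsub>D\<^esub> \<sigma>\<^sub>2) [^]\<^bsub>D\<^esub> Suc k) (p i)
      = \<phi> ((\<sigma>\<^sub>1 \<otimes>\<^bsub>D\<^esub> \<sigma>\<^sub>2) [^]\<^bsub>D\<^esub> k) (\<phi> (\<sigma>\<^sub>1 \<otimes>\<^bsub>D\<^esub> \<sigma>\<^sub>2) (p i))"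
    using act.composition_rule[OF strand_act(1)[OF assms, of i]] involutions by simp
  then show ?case
    using Suc[of "i - 1"] strand_act(4)[OF assms] by (simp add: algebra_simps)
qed

lemma strand_shift:
  assumes "strands p q"
  obtains g where "g \<in> carrier \<Gamma>\<^sub>3" "\<phi> g (p i) = p k"
proof
  \<comment> \<open>Each rotation lowers the index by one, so \<open>i - k\<close> rotations are
    wanted; reducing modulo \<open>n\<close> makes this a natural number.\<close>
  let ?\<rho> = "\<sigma>\<^sub>1 \<otimes>\<^bsub>D\<^esub> \<sigma>\<^sub>2" and ?m = "nat ((i - k) mod int n)"
  show "?\<rho> [^]\<^bsub>D\<^esub> ?m \<in> carrier \<Gamma>\<^sub>3"
    unfolding carrier_subgroup_generated_by_singleton[OF m_closed[OF involutions(1,2)]]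
    by (metis int_pow_int rangeI)
  have "p (i - int ?m) = p k"
  proof (rule periodic_mod[where p=p])
    show "p (i + int n) = p i" for i using assms by (simp add: strands_def)
    have "[i - (i - k) mod int n = i - (i - k)] (mod int n)"
      by (intro cong_diff) (auto simp: cong_def)
    then show "[i - int ?m = k] (mod int n)" using n_pos by simp
  qed
  then show "\<phi> (?\<rho> [^]\<^bsub>D\<^esub> ?m) (p i) = p k" using rotation_pow[OF assms] by simp
qed

lemma pullback_strand:
  assumes pq: "strands p q"
  shows "f \<in> pullbacks_deg \<Gamma>\<^sub>1 G \<phi> d \<Longrightarrow> f (q (1 - i)) = f (p i)"
    and "f \<in> pullbacks_deg \<Gamma>\<^sub>2 G \<phi> d \<Longrightarrow> f (q (2 - i)) = f (p i)"
    and "f \<in> pullbacks_deg \<Gamma>\<^sub>3 G \<phi> d \<Longrightarrow> f (p i) = f (p k)"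
proof -
  note p = strand_act[OF pq, of i]
  show "f (q (1 - i)) = f (p i)" if "f \<in> pullbacks_deg \<Gamma>\<^sub>1 G \<phi> d"
    using generated_invariant[OF that generator_mem[OF involutions(1)] p(1)] p(2) by simp
  show "f (q (2 - i)) = f (p i)" if "f \<in> pullbacks_deg \<Gamma>\<^sub>2 G \<phi> d"
    using generated_invariant[OF that generator_mem[OF involutions(2)] p(1)] p(3) by simp
  obtain g where g: "g \<in> carrier \<Gamma>\<^sub>3" "\<phi> g (p i) = p k" by (rule strand_shift[OF pq])
  show "f (p i) = f (p k)" if "f \<in> pullbacks_deg \<Gamma>\<^sub>3 G \<phi> d"
    using generated_invariant[OF that g(1) p(1)] g(2) by simp
qed

text \<open>For the reflections, the degree on \<open>G\<close> is \<open>2 * d\<close>, so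
  \<open>weight_reflect\<close> with \<open>c = 1\<close> or \<open>c = 2\<close> yields the claim
  up to a factor 2, which is invertible modulo the odd number \<open>n\<close>.\<close>

lemma pullbacks_weight:
  shows "f \<in> pullbacks_deg \<Gamma>\<^sub>1 G \<phi> d \<Longrightarrow> [weight f = d] (mod int n)"
    and "f \<in> pullbacks_deg \<Gamma>\<^sub>2 G \<phi> d \<Longrightarrow> [weight f = 2 * d] (mod int n)"
    and "f \<in> pullbacks_deg \<Gamma>\<^sub>3 G \<phi> d \<Longrightarrow> [weight f = 0] (mod int n)"
proof -
  have cancel: "[a = b] (mod int n)" if "[2 * a = 2 * b] (mod int n)" for a b :: int
    using that odd_n by (subst (asm) cong_mult_lcancel) (auto simp: coprime_commute)
  show "[weight f = d] (mod int n)" if f: "f \<in> pullbacks_deg \<Gamma>\<^sub>1 G \<phi> d"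
  proof (rule cancel)
    have "[2 * weight f = 1 * (\<Sum>v\<in>verts G. f v)] (mod int n)"
      by (rule weight_reflect) (rule pullback_strand(1)[OF _ f])
    then show "[2 * weight f = 2 * d] (mod int n)"
      using generated_degree[OF f] by (simp add: order_generated)
  qed
  show "[weight f = 2 * d] (mod int n)" if f: "f \<in> pullbacks_deg \<Gamma>\<^sub>2 G \<phi> d"
  proof (rule cancel)
    have "[2 * weight f = 2 * (\<Sum>v\<in>verts G. f v)] (mod int n)"
      by (rule weight_reflect) (rule pullback_strand(2)[OF _ f])
    then show "[2 * weight f = 2 * (2 * d)] (mod int n)"
      using generated_degree[OF f] by (simp add: order_generated)
  qed
  show "[weight f = 0] (mod int n)" if f: "f \<in> pullbacks_deg \<Gamma>\<^sub>3 G \<phi> d"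
  proof -
    \<comment> \<open>Since \<open>f\<close> is constant on the strand, replacing \<open>i\<close>
      by \<open>- i\<close> negates the sum, yet it preserves the sum modulo \<open>n\<close> by
      periodicity. Hence twice the sum vanishes.\<close>
    have zero: "[(\<Sum>i=1..int n. i * f (p i)) = 0] (mod int n)" if "strands p q" for p q
    proof (rule cancel)
      have "[(\<Sum>i=1..int n. (0 - i) * f (p (0 - i))) = (\<Sum>i=1..int n. i * f (p i))] (mod int n)"
        using that n_pos by (intro weighted_sum_periodic_reflect) (auto simp: strands_def)
      moreover have "(\<Sum>i=1..int n. (0 - i) * f (p (0 - i))) = - (\<Sum>i=1..int n. i * f (p i))"
        using pullback_strand(3)[OF that f, of "- i" i for i] by (simp add: sum_negf)
      ultimately show "[2 * (\<Sum>i=1..int n. i * f (p i)) = 2 * 0] (mod int n)"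
        by (simp add: cong_iff_dvd_diff)
    qed
    have "[weight f = (\<Sum>j=1..s. 0) + (\<Sum>j=1..t. 0 + 0)] (mod int n)"
      unfolding weight_alt
      by (intro cong_add cong_sum zero[OF strands_z] zero[OF strands_xy]
          zero[OF strands_sym[OF strands_xy]])
    then show ?thesis by simp
  qed
qed

section \<open>Sums of pullbacks\<close>

definition point :: "'v \<Rightarrow> 'v \<Rightarrow> int" where
  "point v = (\<lambda>w. if w = v then 1 else 0)"

text \<open>If \<open>\<sigma>\<close> moves \<open>v\<close>, the orbit has two points with trivial
  stabilizers. If it fixes \<open>v\<close>, the two summands coincide and give the coefficient 2,
  the size of the stabilizer.\<close>

lemma reflection_pullback:
  assumes "\<sigma> \<in> carrier D" "\<sigma> \<otimes>\<^bsub>D\<^esub> \<sigma> = \<one>\<^bsub>D\<^esub>" "\<sigma> \<noteq> \<one>\<^bsub>D\<^esub>" and v: "v \<in> verts G"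
  shows "(\<lambda>w. point v w + point (\<phi> \<sigma> v) w) \<in> pullbacks_deg (subgroup_generated D {\<sigma>}) G \<phi> 1"
proof -
  let ?\<Gamma> = "subgroup_generated D {\<sigma>}"
  have car: "carrier ?\<Gamma> = {\<one>\<^bsub>D\<^esub>, \<sigma>}"
    using assms by (intro carrier_subgroup_generated_involution)
  have one: "\<phi> \<one>\<^bsub>D\<^esub> w = w" if "w \<in> verts G" for w
    using act.id_eq_one that by (metis restrict_apply')
  have invol: "\<phi> \<sigma> (\<phi> \<sigma> v) = v"
    using act.composition_rule[of v \<sigma> \<sigma>] assms one by simp
  have \<sigma>v: "\<phi> \<sigma> v \<in> verts G" using act.element_image[OF assms(1) v] by simp
  have orb: "orbit ?\<Gamma> \<phi> v = {v, \<phi> \<sigma> v}"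
    using one[OF v] by (auto simp: orbit_def car intro: exI[of _ "\<one>\<^bsub>D\<^esub>"])
  have stab: "card (stabilizer ?\<Gamma> \<phi> w) = (if \<phi> \<sigma> w = w then 2 else 1)" if "w \<in> verts G" for w
  proof -
    have "stabilizer ?\<Gamma> \<phi> w = (if \<phi> \<sigma> w = w then {\<one>\<^bsub>D\<^esub>, \<sigma>} else {\<one>\<^bsub>D\<^esub>})"
      using one[OF that] by (auto simp: stabilizer_def car)
    then show ?thesis using assms(3) by auto
  qed
  have "(\<lambda>w. point v w + point (\<phi> \<sigma> v) w)
      = (\<lambda>w. if w \<in> orbit ?\<Gamma> \<phi> v then int (card (stabilizer ?\<Gamma> \<phi> w)) else 0)"
    using v \<sigma>v stab invol by (auto simp: orb point_def fun_eq_iff)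
  then show ?thesis using generated_orbit[OF v] by simp
qed

lemma strand_pullbacks:
  assumes pq: "strands p q"
  shows "(\<lambda>w. point (p i) w + point (q (1 - i)) w) \<in> pullbacks_deg \<Gamma>\<^sub>1 G \<phi> 1"
    and "(\<lambda>w. point (p i) w + point (q (2 - i)) w) \<in> pullbacks_deg \<Gamma>\<^sub>2 G \<phi> 1"
    and "(\<lambda>w. \<Sum>k=1..int n. point (p k) w) \<in> pullbacks_deg \<Gamma>\<^sub>3 G \<phi> 1"
proof -
  note p = strand_act[OF pq]
  show "(\<lambda>w. point (p i) w + point (q (1 - i)) w) \<in> pullbacks_deg \<Gamma>\<^sub>1 G \<phi> 1"
    "(\<lambda>w. point (p i) w + point (q (2 - i)) w) \<in> pullbacks_deg \<Gamma>\<^sub>2 G \<phi> 1"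
    using reflection_pullback[of \<sigma>\<^sub>1 "p i"] reflection_pullback[of \<sigma>\<^sub>2 "p i"] involutions p by auto
  \<comment> \<open>The rotation group has order \<open>n\<close>, and its orbit of
    \<open>p 1\<close> contains the \<open>n\<close> distinct points of the strand. So the orbit is
    exactly the strand and all its stabilizers are trivial.\<close>
  interpret \<Gamma>3: group_action \<Gamma>\<^sub>3 "verts G" \<phi> by (rule generated_action)
  let ?O = "orbit \<Gamma>\<^sub>3 \<phi> (p 1)"
  have inj: "inj_on p {1..int n}" using pq by (simp add: strands_def)
  have finO: "finite ?O" using finite_generated by (simp add: orbit_def)
  have "p k \<in> ?O" for k
  proof -
    obtain g where "g \<in> carrier \<Gamma>\<^sub>3" "\<phi> g (p 1) = p k" by (rule strand_shift[OF pq])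
    then show ?thesis unfolding orbit_def by (intro CollectI exI[of _ g]) simp
  qed
  then have sub: "p ` {1..int n} \<subseteq> ?O" by auto
  have card_p: "card (p ` {1..int n}) = n" using inj by (simp add: card_image)
  have le: "n \<le> card ?O" using card_mono[OF finO sub] card_p by simp
  have os: "card ?O * card (stabilizer \<Gamma>\<^sub>3 \<phi> (p 1)) = n"
    using \<Gamma>3.orbit_stabilizer_theorem[OF p(1)] order_generated(3) by simp
  then have "card ?O = n"
    using le n_pos by (metis dvd_imp_le dvd_triv_left le_antisym)
  then have O: "?O = p ` {1..int n}"
    using card_subset_eq[OF finO sub] card_p by simp
  have stab: "card (stabilizer \<Gamma>\<^sub>3 \<phi> w) = 1" if "w \<in> ?O" for w
  proof -
    have "w \<in> verts G" using that O p(1) by auto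
    then have "card ?O * card (stabilizer \<Gamma>\<^sub>3 \<phi> w) = n"
      using \<Gamma>3.orbit_stabilizer_theorem[of w] \<Gamma>3.orbit_eq[OF p(1) that] order_generated(3) by simp
    then show ?thesis using \<open>card ?O = n\<close> n_pos by simp
  qed
  have "(\<Sum>k=1..int n. point (p k) w) = (if w \<in> ?O then int (card (stabilizer \<Gamma>\<^sub>3 \<phi> w)) else 0)" for w
  proof -
    have "(\<Sum>k=1..int n. point (p k) w) = (\<Sum>v\<in>p ` {1..int n}. point v w)"
      using inj by (simp add: sum.reindex)
    also have "\<dots> = (if w \<in> ?O then 1 else 0)"
      using O by (simp add: point_def)
    finally show ?thesis using stab by simp
  qed
  then show "(\<lambda>w. \<Sum>k=1..int n. point (p k) w) \<in> pullbacks_deg \<Gamma>\<^sub>3 G \<phi> 1"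
    using generated_orbit[OF p(1)] by simp
qed

section \<open>The group \<open>A\<^sub>1 + A\<^sub>2 + A\<^sub>3\<close> and its closure
  properties\<close>

definition all_pullbacks :: "('v \<Rightarrow> int) set" where
  "all_pullbacks = {(\<lambda>v. f\<^sub>1 v + f\<^sub>2 v + f\<^sub>3 v) | f\<^sub>1 f\<^sub>2 f\<^sub>3 d\<^sub>1 d\<^sub>2 d\<^sub>3.
     f\<^sub>1 \<in> pullbacks_deg \<Gamma>\<^sub>1 G \<phi> d\<^sub>1 \<and> f\<^sub>2 \<in> pullbacks_deg \<Gamma>\<^sub>2 G \<phi> d\<^sub>2 \<and> f\<^sub>3 \<in> pullbacks_deg \<Gamma>\<^sub>3 G \<phi> d\<^sub>3}"

lemma all_pullbacksI:
  assumes "f\<^sub>1 \<in> pullbacks_deg \<Gamma>\<^sub>1 G \<phi> d\<^sub>1" "f\<^sub>2 \<in> pullbacks_deg \<Gamma>\<^sub>2 G \<phi> d\<^sub>2" "f\<^sub>3 \<in> pullbacks_deg \<Gamma>\<^sub>3 G \<phi> d\<^sub>3"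
  shows "(\<lambda>v. f\<^sub>1 v + f\<^sub>2 v + f\<^sub>3 v) \<in> all_pullbacks"
  using assms unfolding all_pullbacks_def by blast

lemma pullbacks_subset:
  "pullbacks_deg \<Gamma>\<^sub>1 G \<phi> d \<subseteq> all_pullbacks" "pullbacks_deg \<Gamma>\<^sub>2 G \<phi> d \<subseteq> all_pullbacks"
  "pullbacks_deg \<Gamma>\<^sub>3 G \<phi> d \<subseteq> all_pullbacks"
  using all_pullbacksI[OF _ pullbacks_deg_zero pullbacks_deg_zero]
    all_pullbacksI[OF pullbacks_deg_zero _ pullbacks_deg_zero]
    all_pullbacksI[OF pullbacks_deg_zero pullbacks_deg_zero]
  by auto

lemma all_pullbacks_zero: "(\<lambda>v. 0) \<in> all_pullbacks"
  by (rule subsetD[OF pullbacks_subset(1) pullbacks_deg_zero])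

lemma all_pullbacks_lin:
  assumes "f \<in> all_pullbacks" "g \<in> all_pullbacks"
  shows "(\<lambda>v. a * f v + b * g v) \<in> all_pullbacks"
proof -
  obtain f\<^sub>1 f\<^sub>2 f\<^sub>3 d\<^sub>1 d\<^sub>2 d\<^sub>3 where f: "f = (\<lambda>v. f\<^sub>1 v + f\<^sub>2 v + f\<^sub>3 v)" "f\<^sub>1 \<in> pullbacks_deg \<Gamma>\<^sub>1 G \<phi> d\<^sub>1"
     "f\<^sub>2 \<in> pullbacks_deg \<Gamma>\<^sub>2 G \<phi> d\<^sub>2" "f\<^sub>3 \<in> pullbacks_deg \<Gamma>\<^sub>3 G \<phi> d\<^sub>3"
    using assms(1) unfolding all_pullbacks_def by blast
  obtain g\<^sub>1 g\<^sub>2 g\<^sub>3 e\<^sub>1 e\<^sub>2 e\<^sub>3 where g: "g = (\<lambda>v. g\<^sub>1 v + g\<^sub>2 v + g\<^sub>3 v)" "g\<^sub>1 \<in> pullbacks_deg \<Gamma>\<^sub>1 G \<phi> e\<^sub>1"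
     "g\<^sub>2 \<in> pullbacks_deg \<Gamma>\<^sub>2 G \<phi> e\<^sub>2" "g\<^sub>3 \<in> pullbacks_deg \<Gamma>\<^sub>3 G \<phi> e\<^sub>3"
    using assms(2) unfolding all_pullbacks_def by blast
  have "(\<lambda>v. (a * f\<^sub>1 v + b * g\<^sub>1 v) + (a * f\<^sub>2 v + b * g\<^sub>2 v) + (a * f\<^sub>3 v + b * g\<^sub>3 v)) \<in> all_pullbacks"
    by (rule all_pullbacksI[OF pullbacks_deg_lin[OF f(2) g(2)] pullbacks_deg_lin[OF f(3) g(3)]
          pullbacks_deg_lin[OF f(4) g(4)]])
  moreover have "(\<lambda>v. a * f v + b * g v)
      = (\<lambda>v. (a * f\<^sub>1 v + b * g\<^sub>1 v) + (a * f\<^sub>2 v + b * g\<^sub>2 v) + (a * f\<^sub>3 v + b * g\<^sub>3 v))"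
    by (simp add: f(1) g(1) algebra_simps)
  ultimately show ?thesis by simp
qed

lemma all_pullbacks_add: "f \<in> all_pullbacks \<Longrightarrow> g \<in> all_pullbacks \<Longrightarrow> (\<lambda>v. f v + g v) \<in> all_pullbacks"
  using all_pullbacks_lin[of f g 1 1] by simp

lemma all_pullbacks_diff: "f \<in> all_pullbacks \<Longrightarrow> g \<in> all_pullbacks \<Longrightarrow> (\<lambda>v. f v - g v) \<in> all_pullbacks"
  using all_pullbacks_lin[of f g 1 "- 1"] by simp

lemma all_pullbacks_scale: "f \<in> all_pullbacks \<Longrightarrow> (\<lambda>v. a * f v) \<in> all_pullbacks"
  using all_pullbacks_lin[of f f a 0] by simp

lemma all_pullbacks_sum:
  assumes "finite I" "\<And>i. i \<in> I \<Longrightarrow> f i \<in> all_pullbacks"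
  shows "(\<lambda>v. \<Sum>i\<in>I. f i v) \<in> all_pullbacks"
  using assms
proof (induction I rule: finite_induct)
  case empty
  then show ?case by (simp add: all_pullbacks_zero)
next
  case (insert i I)
  then show ?case by (simp add: all_pullbacks_add)
qed

section \<open>Elements of the group supported on one pair of strands\<close>

lemma point_diff:
  assumes pq: "strands p q"
  shows "(\<lambda>w. point (p i) w - point (p k) w) \<in> all_pullbacks"
proof -
  \<comment> \<open>The vertex \<open>q (1 - i)\<close> is paired with \<open>p (i + 1)\<close> by
    \<open>\<sigma>\<^sub>2\<close> and with \<open>p i\<close> by \<open>\<sigma>\<^sub>1\<close>;
    subtracting the two pullbacks removes it. Larger index differences telescope.\<close>
  have step: "(\<lambda>w. point (p (i + 1)) w - point (p i) w) \<in> all_pullbacks" for i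
    using all_pullbacks_diff[OF subsetD[OF pullbacks_subset(2) strand_pullbacks(2)[OF strands_sym[OF pq], of "1 - i"]]
        subsetD[OF pullbacks_subset(1) strand_pullbacks(1)[OF strands_sym[OF pq], of "1 - i"]]]
    by (simp add: algebra_simps)
  have up: "(\<lambda>w. point (p (i + int m)) w - point (p i) w) \<in> all_pullbacks" for i m
  proof (induction m)
    case 0
    then show ?case by (simp add: all_pullbacks_zero)
  next
    case (Suc m)
    show ?case using all_pullbacks_add[OF Suc step[of "i + int m"]] by (simp add: algebra_simps)
  qed
  show ?thesis
  proof (cases "k \<le> i")
    case True
    then show ?thesis using up[of k "nat (i - k)"] by simp
  next
    case False
    then show ?thesis using all_pullbacks_scale[OF up[of i "nat (k - i)"], of "- 1"] by simp
  qed
qed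

text \<open>The case \<open>k = 1 - i\<close> is a pullback along \<open>\<sigma>\<^sub>1\<close>,
  and \<open>point_diff\<close> moves the second point along its strand.\<close>

lemma point_sum:
  assumes "strands p q"
  shows "(\<lambda>w. point (p i) w + point (q k) w) \<in> all_pullbacks"
  using all_pullbacks_add[OF subsetD[OF pullbacks_subset(1) strand_pullbacks(1)[OF assms, of i]]
      point_diff[OF strands_sym[OF assms], of k "1 - i"]] by (simp add: algebra_simps)

text \<open>The whole strand is a pullback along the rotations, and differences carry its
  \<open>n\<close> points to \<open>p i\<close>.\<close>

lemma n_point:
  assumes "strands p q"
  shows "(\<lambda>w. int n * point (p i) w) \<in> all_pullbacks"
proof -
  have "(\<lambda>w. (\<Sum>k=1..int n. point (p k) w) + (\<Sum>k=1..int n. point (p i) w - point (p k) w)) \<in> all_pullbacks"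
    by (intro all_pullbacks_add all_pullbacks_sum point_diff[OF assms]
        subsetD[OF pullbacks_subset(3) strand_pullbacks(3)[OF assms]]) simp
  then show ?thesis by (simp add: sum_subtractf)
qed

lemma point_z:
  assumes "j \<in> {1..s}"
  shows "point (z i j) \<in> all_pullbacks"
proof -
  note z = strands_z[OF assms]
  obtain m where m: "n = 2 * m + 1" using odd_n by (rule oddE)
  \<comment> \<open>With \<open>p = q\<close>, \<open>point_sum\<close> puts twice the vertex into
    the group. As \<open>n - 2 * m = 1\<close>, the vertex itself follows.\<close>
  have "(\<lambda>w. 1 * (int n * point (z i j) w) + (- int m) * (point (z i j) w + point (z i j) w)) \<in> all_pullbacks"
    by (rule all_pullbacks_lin[OF n_point[OF z] point_sum[OF z]])
  moreover have "1 * (int n * a) + (- int m) * (a + a) = a" for a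
    by (simp add: m algebra_simps)
  ultimately show ?thesis by simp
qed

lemma strand_combination:
  assumes pq: "strands p q" and "[(\<Sum>i=1..int n. f (p i)) = (\<Sum>i=1..int n. f (q i))] (mod int n)"
  shows "(\<lambda>w. \<Sum>i=1..int n. f (p i) * point (p i) w + f (q i) * point (q i) w) \<in> all_pullbacks"
proof -
  obtain m where m: "(\<Sum>i=1..int n. f (p i)) - (\<Sum>i=1..int n. f (q i)) = int n * m"
    using assms(2) by (auto simp: cong_iff_dvd_diff)
  \<comment> \<open>All coefficients are carried to \<open>p 1\<close>, those of the
    \<open>q\<close> strand with reversed sign. The surplus there is the difference of the two
    strand sums, a multiple \<open>m\<close> of \<open>n\<close>, which \<open>n_point\<close>
    absorbs.\<close>
  have "(\<lambda>w. (\<Sum>i=1..int n. f (p i) * (point (p i) w - point (p 1) w) + f (q i) * (point (p 1) w + point (q i) w))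
      + m * (int n * point (p 1) w)) \<in> all_pullbacks" (is "?F \<in> _")
    by (intro all_pullbacks_add all_pullbacks_sum all_pullbacks_scale n_point[OF pq]
        point_diff[OF pq] point_sum[OF pq]) simp
  moreover have "?F w = (\<Sum>i=1..int n. f (p i) * point (p i) w + f (q i) * point (q i) w)" for w
  proof -
    have "?F w = (\<Sum>i=1..int n. f (p i) * point (p i) w + f (q i) * point (q i) w)
        - ((\<Sum>i=1..int n. f (p i)) - (\<Sum>i=1..int n. f (q i))) * point (p 1) w + m * (int n * point (p 1) w)"
      by (simp add: distrib_left right_diff_distrib left_diff_distrib sum.distrib sum_subtractf sum_distrib_right)
    then show ?thesis by (simp add: m)
  qed
  ultimately show ?thesis by simp
qed

text \<open>Expand \<open>\<delta>\<close> into points: \<open>point_z\<close> handles every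
  \<open>z\<close> term separately, and the congruence lets \<open>strand_combination\<close> handle
  each \<open>x\<close>, \<open>y\<close> orbit as a whole.\<close>

lemma all_pullbacks_mem:
  assumes supp: "\<And>v. v \<notin> verts G \<Longrightarrow> \<delta> v = 0"
    and "\<forall>j\<in>{1..t}. [(\<Sum>i=1..int n. \<delta> (x i j)) = (\<Sum>i=1..int n. \<delta> (y i j))] (mod int n)"
  shows "\<delta> \<in> all_pullbacks"
proof -
  have "\<delta> w = (\<Sum>v\<in>verts G. \<delta> v * point v w)" for w
  proof -
    have "(\<Sum>v\<in>verts G. \<delta> v * point v w) = (\<Sum>v\<in>verts G. if w = v then \<delta> v else 0)"
      by (rule sum.cong) (auto simp: point_def)
    then show ?thesis using finite_verts supp[of w] by simp
  qed
  then have "\<delta> = (\<lambda>w. (\<Sum>j=1..s. \<Sum>i=1..int n. \<delta> (z i j) * point (z i j) w)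
      + (\<Sum>j=1..t. \<Sum>i=1..int n. \<delta> (x i j) * point (x i j) w + \<delta> (y i j) * point (y i j) w))"
    unfolding sum_verts by (rule ext)
  also have "\<dots> \<in> all_pullbacks"
    by (intro all_pullbacks_add all_pullbacks_sum all_pullbacks_scale point_z
        strand_combination[OF strands_xy]) (use assms(2) in auto)
  finally show ?thesis .
qed

section \<open>A divisor for shifting degrees between the summands\<close>

lemma ex_strands: "\<exists>p q. strands p q"
proof (cases "s = 0 \<and> t = 0")
  case True
  obtain v where "v \<in> verts G" using verts_nonempty by auto
  then have "orbit D \<phi> v \<in> orbits D (verts G) \<phi>" by (auto simp: orbits_def)
  then have "orbit D \<phi> v \<in> {B \<in> orbits D (verts G) \<phi>. card B = n} \<union> {B \<in> orbits D (verts G) \<phi>. card B = 2 * n}"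
    using orbit_sizes by auto
  moreover have "{B \<in> orbits D (verts G) \<phi>. card B = n} = {}" "{B \<in> orbits D (verts G) \<phi>. card B = 2 * n} = {}"
    using labelling True by (simp_all add: dihedral_labelling_def bij_betw_def)
  ultimately show ?thesis by simp
next
  case False
  then have "1 \<in> {1..s} \<or> 1 \<in> {1..t}" by auto
  then show ?thesis using strands_z strands_xy by blast
qed

lemma full_orbit_pullback:
  obtains u where "u \<in> pullbacks_deg \<Gamma>\<^sub>1 G \<phi> (int n)" "u \<in> pullbacks_deg \<Gamma>\<^sub>2 G \<phi> (int n)"
    "u \<in> pullbacks_deg \<Gamma>\<^sub>3 G \<phi> 2"
proof -
  obtain p q where pq: "strands p q" using ex_strands by blast
  \<comment> \<open>For an orbit of size \<open>n\<close> the strands coincide and each vertex gets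
    coefficient 2, so the degrees are the same for both kinds of orbits.\<close>
  define u where "u w = (\<Sum>i=1..int n. point (p i) w) + (\<Sum>i=1..int n. point (q i) w)" for w
  \<comment> \<open>Pairing \<open>p i\<close> with \<open>q (c - i)\<close> for all
    \<open>i\<close> exhausts both strands whatever \<open>c\<close> is; \<open>c = 1\<close> and
    \<open>c = 2\<close> give \<open>n\<close> pullbacks of degree one for each reflection.\<close>
  have refl: "(\<lambda>w. \<Sum>i=1..int n. point (p i) w + point (q (c - i)) w) = u" for c
  proof
    fix w
    have "(\<Sum>i=1..int n. point (q (c - i)) w) = (\<Sum>i=1..int n. point (q i) w)"
      by (rule sum_periodic_reflect) (use pq n_pos in \<open>auto simp: strands_def\<close>)
    then show "(\<Sum>i=1..int n. point (p i) w + point (q (c - i)) w) = u w"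
      by (simp add: u_def sum.distrib)
  qed
  show ?thesis
  proof
    show "u \<in> pullbacks_deg \<Gamma>\<^sub>1 G \<phi> (int n)"
      using pullbacks_deg_sum[OF _ strand_pullbacks(1)[OF pq], of "{1..int n}" "\<lambda>i. i"] by (simp add: refl)
    show "u \<in> pullbacks_deg \<Gamma>\<^sub>2 G \<phi> (int n)"
      using pullbacks_deg_sum[OF _ strand_pullbacks(2)[OF pq], of "{1..int n}" "\<lambda>i. i"] by (simp add: refl)
    show "u \<in> pullbacks_deg \<Gamma>\<^sub>3 G \<phi> 2"
      using pullbacks_deg_lin[OF strand_pullbacks(3)[OF pq] strand_pullbacks(3)[OF strands_sym[OF pq]], of 1 1]
      by (simp add: u_def[abs_def])
  qed
qed

text \<open>A reflection exchanges the strands, so the sums even agree. A rotation pullback is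
  constant on each strand, so both sums are multiples of \<open>n\<close>.\<close>

lemma strand_sum_cong:
  assumes pq: "strands p q"
  shows "f \<in> pullbacks_deg \<Gamma>\<^sub>1 G \<phi> d \<Longrightarrow> [(\<Sum>i=1..int n. f (p i)) = (\<Sum>i=1..int n. f (q i))] (mod int n)"
    and "f \<in> pullbacks_deg \<Gamma>\<^sub>2 G \<phi> d \<Longrightarrow> [(\<Sum>i=1..int n. f (p i)) = (\<Sum>i=1..int n. f (q i))] (mod int n)"
    and "f \<in> pullbacks_deg \<Gamma>\<^sub>3 G \<phi> d \<Longrightarrow> [(\<Sum>i=1..int n. f (p i)) = (\<Sum>i=1..int n. f (q i))] (mod int n)"
proof -
  show "[(\<Sum>i=1..int n. f (p i)) = (\<Sum>i=1..int n. f (q i))] (mod int n)" if "f \<in> pullbacks_deg \<Gamma>\<^sub>1 G \<phi> d"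
    using strand_weight_reflect(2)[OF pq pullback_strand(1)[OF pq that]] by simp
  show "[(\<Sum>i=1..int n. f (p i)) = (\<Sum>i=1..int n. f (q i))] (mod int n)" if "f \<in> pullbacks_deg \<Gamma>\<^sub>2 G \<phi> d"
    using strand_weight_reflect(2)[OF pq pullback_strand(2)[OF pq that]] by simp
  show "[(\<Sum>i=1..int n. f (p i)) = (\<Sum>i=1..int n. f (q i))] (mod int n)" if "f \<in> pullbacks_deg \<Gamma>\<^sub>3 G \<phi> d"
  proof -
    have "(\<Sum>i=1..int n. f (r i)) = int n * f (r 0)" if r: "strands r r'" for r r'
    proof -
      have "(\<Sum>i=1..int n. f (r i)) = (\<Sum>i=1..int n. f (r 0))"
        by (rule sum.cong[OF refl pullback_strand(3)[OF r \<open>f \<in> _\<close>]])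
      then show ?thesis by simp
    qed
    from this[OF pq] this[OF strands_sym[OF pq]] show ?thesis by (simp add: cong_def)
  qed
qed

section \<open>The criterion for degree zero on all three quotients\<close>

lemma pullback_sumI:
  assumes "f\<^sub>1 \<in> pullbacks_deg \<Gamma>\<^sub>1 G \<phi> 0" "f\<^sub>2 \<in> pullbacks_deg \<Gamma>\<^sub>2 G \<phi> 0" "f\<^sub>3 \<in> pullbacks_deg \<Gamma>\<^sub>3 G \<phi> 0"
  shows "(\<lambda>v. f\<^sub>1 v + f\<^sub>2 v + f\<^sub>3 v) \<in> pullback_sum D \<sigma>\<^sub>1 \<sigma>\<^sub>2 G \<phi> \<psi>"
  using assms unfolding pullback_sum_def pullbacks_deg0_eq by blast

theorem pullback_sum_iff:
  assumes "\<delta> \<in> divisors G" and "divisor_degree G \<delta> = 0"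
  shows "\<delta> \<in> pullback_sum D \<sigma>\<^sub>1 \<sigma>\<^sub>2 G \<phi> \<psi> \<longleftrightarrow> [weight \<delta> = 0] (mod int n) \<and>
    (\<forall>j\<in>{1..t}. [(\<Sum>i=1..int n. \<delta> (x i j)) = (\<Sum>i=1..int n. \<delta> (y i j))] (mod int n))"
proof (intro iffI conjI ballI)
  assume "\<delta> \<in> pullback_sum D \<sigma>\<^sub>1 \<sigma>\<^sub>2 G \<phi> \<psi>"
  then obtain f\<^sub>1 f\<^sub>2 f\<^sub>3 where \<delta>: "\<delta> = (\<lambda>v. f\<^sub>1 v + f\<^sub>2 v + f\<^sub>3 v)" and
    f: "f\<^sub>1 \<in> pullbacks_deg \<Gamma>\<^sub>1 G \<phi> 0" "f\<^sub>2 \<in> pullbacks_deg \<Gamma>\<^sub>2 G \<phi> 0" "f\<^sub>3 \<in> pullbacks_deg \<Gamma>\<^sub>3 G \<phi> 0"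
    unfolding pullback_sum_def pullbacks_deg0_eq by blast
  have "[weight f\<^sub>1 + weight f\<^sub>2 + weight f\<^sub>3 = 0 + 2 * 0 + 0] (mod int n)"
    by (intro cong_add pullbacks_weight(1)[OF f(1)] pullbacks_weight(2)[OF f(2)] pullbacks_weight(3)[OF f(3)])
  then show "[weight \<delta> = 0] (mod int n)" by (simp add: \<delta> weight_add)
  fix j assume "j \<in> {1..t}"
  note xy = strands_xy[OF this]
  show "[(\<Sum>i=1..int n. \<delta> (x i j)) = (\<Sum>i=1..int n. \<delta> (y i j))] (mod int n)"
    unfolding \<delta> sum.distrib
    by (intro cong_add strand_sum_cong(1)[OF xy f(1)] strand_sum_cong(2)[OF xy f(2)]
        strand_sum_cong(3)[OF xy f(3)])
next
  assume cond: "[weight \<delta> = 0] (mod int n) \<and>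
    (\<forall>j\<in>{1..t}. [(\<Sum>i=1..int n. \<delta> (x i j)) = (\<Sum>i=1..int n. \<delta> (y i j))] (mod int n))"
  then have "\<delta> \<in> all_pullbacks"
    using assms(1) by (intro all_pullbacks_mem) (auto simp: divisors_def)
  then obtain f\<^sub>1 f\<^sub>2 f\<^sub>3 d\<^sub>1 d\<^sub>2 d\<^sub>3 where \<delta>: "\<delta> = (\<lambda>v. f\<^sub>1 v + f\<^sub>2 v + f\<^sub>3 v)" and
    f: "f\<^sub>1 \<in> pullbacks_deg \<Gamma>\<^sub>1 G \<phi> d\<^sub>1" "f\<^sub>2 \<in> pullbacks_deg \<Gamma>\<^sub>2 G \<phi> d\<^sub>2" "f\<^sub>3 \<in> pullbacks_deg \<Gamma>\<^sub>3 G \<phi> d\<^sub>3"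
    unfolding all_pullbacks_def by blast
  have deg: "2 * d\<^sub>1 + 2 * d\<^sub>2 + int n * d\<^sub>3 = 0"
    using assms(2) generated_degree[OF f(1)] generated_degree[OF f(2)] generated_degree[OF f(3)]
    by (simp add: \<delta> divisor_degree_def sum.distrib order_generated)
  have "[weight f\<^sub>1 + weight f\<^sub>2 + weight f\<^sub>3 = d\<^sub>1 + 2 * d\<^sub>2 + 0] (mod int n)"
    by (intro cong_add pullbacks_weight(1)[OF f(1)] pullbacks_weight(2)[OF f(2)] pullbacks_weight(3)[OF f(3)])
  then have "[weight \<delta> = d\<^sub>1 + 2 * d\<^sub>2] (mod int n)" by (simp add: \<delta> weight_add)
  with cond have "[d\<^sub>1 + 2 * d\<^sub>2 = 0] (mod int n)" using cong_sym cong_trans by blast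
  then have n1: "int n dvd d\<^sub>1 + 2 * d\<^sub>2" by (simp add: cong_iff_dvd_diff)
  have "int n * d\<^sub>3 = 2 * (- d\<^sub>1 - d\<^sub>2)" using deg by simp
  then have "even (int n * d\<^sub>3)" by (metis dvd_triv_left)
  then obtain k\<^sub>3 where k3: "d\<^sub>3 = 2 * k\<^sub>3" using odd_n by auto
  have s12: "d\<^sub>1 + d\<^sub>2 = int n * (- k\<^sub>3)" using deg by (simp add: k3)
  \<comment> \<open>Both \<open>d\<^sub>1 + 2 * d\<^sub>2\<close> and
    \<open>d\<^sub>1 + d\<^sub>2\<close> are divisible by \<open>n\<close>, hence so is their
    difference.\<close>
  have "d\<^sub>2 = (d\<^sub>1 + 2 * d\<^sub>2) - int n * (- k\<^sub>3)" using s12 by simp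
  then have "int n dvd d\<^sub>2" using n1 by (metis dvd_diff dvd_triv_left)
  then obtain k\<^sub>2 where k2: "d\<^sub>2 = int n * k\<^sub>2" by auto
  \<comment> \<open>Chosen so that \<open>k\<^sub>1 + k\<^sub>2 + k\<^sub>3 = 0\<close>: subtracting
    these multiples of \<open>u\<close> from the three summands leaves their sum unchanged.\<close>
  define k\<^sub>1 where "k\<^sub>1 = - k\<^sub>3 - k\<^sub>2"
  have k1: "d\<^sub>1 = int n * k\<^sub>1" using s12 by (simp add: k2 k\<^sub>1_def algebra_simps)
  obtain u where u: "u \<in> pullbacks_deg \<Gamma>\<^sub>1 G \<phi> (int n)" "u \<in> pullbacks_deg \<Gamma>\<^sub>2 G \<phi> (int n)"
    "u \<in> pullbacks_deg \<Gamma>\<^sub>3 G \<phi> 2" by (rule full_orbit_pullback)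
  have "(\<lambda>v. f\<^sub>1 v - k\<^sub>1 * u v) \<in> pullbacks_deg \<Gamma>\<^sub>1 G \<phi> 0"
    using pullbacks_deg_lin[OF f(1) u(1), of 1 "- k\<^sub>1"] by (simp add: k1)
  moreover have "(\<lambda>v. f\<^sub>2 v - k\<^sub>2 * u v) \<in> pullbacks_deg \<Gamma>\<^sub>2 G \<phi> 0"
    using pullbacks_deg_lin[OF f(2) u(2), of 1 "- k\<^sub>2"] by (simp add: k2)
  moreover have "(\<lambda>v. f\<^sub>3 v - k\<^sub>3 * u v) \<in> pullbacks_deg \<Gamma>\<^sub>3 G \<phi> 0"
    using pullbacks_deg_lin[OF f(3) u(3), of 1 "- k\<^sub>3"] by (simp add: k3)
  moreover have "\<delta> = (\<lambda>v. (f\<^sub>1 v - k\<^sub>1 * u v) + (f\<^sub>2 v - k\<^sub>2 * u v) + (f\<^sub>3 v - k\<^sub>3 * u v))"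
    by (simp add: \<delta> k\<^sub>1_def algebra_simps)
  ultimately show "\<delta> \<in> pullback_sum D \<sigma>\<^sub>1 \<sigma>\<^sub>2 G \<phi> \<psi>"
    by (simp only: pullback_sumI)
qed

end

theorem theorem3p3:
  fixes D :: "('g, 'm) monoid_scheme" and n :: nat and \<sigma>\<^sub>1 \<sigma>\<^sub>2 :: 'g
    and G :: "('v, 'e) multigraph"
    and \<phi> :: "'g \<Rightarrow> 'v \<Rightarrow> 'v" and \<psi> :: "'g \<Rightarrow> 'e \<Rightarrow> 'e"
    and s t :: nat and z x y :: "int \<Rightarrow> nat \<Rightarrow> 'v"
    and \<delta> :: "'v \<Rightarrow> int"
  assumes "odd n"
    and "dihedral_group D n \<sigma>\<^sub>1 \<sigma>\<^sub>2"
    and "finite_loopless_graph G" and "connected_graph G"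
    and "harmonic_action D G \<phi> \<psi>"
    and "\<forall>B\<in>orbits D (verts G) \<phi>. card B = n \<or> card B = 2 * n"
    and "dihedral_labelling D n \<sigma>\<^sub>1 \<sigma>\<^sub>2 G \<phi> s t z x y"
    and "\<delta> \<in> divisors G" and "divisor_degree G \<delta> = 0"
  shows "\<delta> \<in> pullback_sum D \<sigma>\<^sub>1 \<sigma>\<^sub>2 G \<phi> \<psi> \<longleftrightarrow>
    [(\<Sum>i=1..int n. i * ((\<Sum>j=1..t. \<delta> (x i j)) + (\<Sum>j=1..t. \<delta> (y i j)) + (\<Sum>j=1..s. \<delta> (z i j)))) = 0]
      (mod int n) \<and>
    (\<forall>j\<in>{1..t}. [(\<Sum>i=1..int n. \<delta> (x i j)) = (\<Sum>i=1..int n. \<delta> (y i j))] (mod int n))"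
proof -
  interpret dihedral_labelled_graph D n \<sigma>\<^sub>1 \<sigma>\<^sub>2 G \<phi> s t z x y
    using assms
    by (intro dihedral_labelled_graph.intro)
       (auto simp: finite_loopless_graph_def connected_graph_def harmonic_action_def graph_action_def)
  show ?thesis
    using pullback_sum_iff[OF assms(8,9)] unfolding weight_def .
qed

end
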